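(* Let $q\in\mathbb{C}^*$ be not a root of unity. Then the group of $\mathbb{C}$-algebra automorphisms of $U_q^+(\mathfrak{sl}_3)$ satisfies $$\mathrm{Aut}(U_q^+(\mathfrak{sl}_3))\simeq(\mathbb{C}^* )^2\rtimes\mathrm{autdiagr}(\mathfrak{sl}_3).$$
   Context: $\mathbb{C}^*=\mathbb{C}\setminus\{0\}$. $U_q^+(\mathfrak{sl}_3)$ is the unital associative $\mathbb{C}$-algebra generated by $E_1,E_2$ subject to the relations $$E_1^2E_2-(q+q^{-1})E_1E_2E_1+E_2E_1^2=0,\qquad E_2^2E_1-(q+q^{-1})E_2E_1E_2+E_1E_2^2=0.$$ The group $\mathrm{autdiagr}(\mathfrak{sl}_3)$ is the group of automorphisms of the Dynkin diagram of $\mathfrak{sl}_3$ (type $A_2$, two vertices joined by a single edge); it is the symmetric group $S_2$ permuting the two vertices. The factor $(\mathbb{C}^* )^2$ corresponds to the torus automorphisms $\phi_{(\lambda_1,\lambda_2)}:E_i\mapsto\lambda_iE_i$ ($i=1,2$, $\lambda_i\in\mathbb{C}^*$), and a diagram automorphism $w$ corresponds to the algebra automorphism $E_i\mapsto E_{w(i)}$; thus in the semidirect product the nontrivial element of $\mathrm{autdiagr}(\mathfrak{sl}_3)$ acts on $(\mathbb{C}^* )^2$ by exchanging the two coordinates. *)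

theory Defs
  imports Complex_Main "HOL-Library.Poly_Mapping" "HOL-Algebra.Algebra"
begin

subsection \<open>The free algebra on a set of generators\<close>

text \<open>
  The free monoid is written additively, because \<^typ>\<open>'a \<Rightarrow>\<^sub>0 'b\<close> is the monoid algebra of an
  additive monoid \<^typ>\<open>'a\<close>. The addition of words is concatenation and is not commutative.
\<close>

datatype 'g word = Word "'g list"

fun letters :: "'g word \<Rightarrow> 'g list" where
  "letters (Word xs) = xs"

instantiation word :: (type) monoid_add
begin

definition zero_word :: "'a word" where
  "0 = Word []"

definition plus_word :: "'a word \<Rightarrow> 'a word \<Rightarrow> 'a word" where
  "u + v = Word (letters u @ letters v)"

instance
proof
  fix a b c :: "'a word"
  show "a + b + c = a + (b + c)" by (simp add: plus_word_def)
  show "0 + a = a" by (cases a) (simp add: plus_word_def zero_word_def)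
  show "a + 0 = a" by (cases a) (simp add: plus_word_def zero_word_def)
qed

end

type_synonym 'g free_alg = "'g word \<Rightarrow>\<^sub>0 complex"

definition scalar :: "complex \<Rightarrow> 'g free_alg" where
  "scalar c = Poly_Mapping.single 0 c"

definition gen :: "'g \<Rightarrow> 'g free_alg" where
  "gen i = Poly_Mapping.single (Word [i]) 1"

definition free_ring :: "'g free_alg ring" where
  "free_ring = \<lparr>carrier = UNIV, monoid.mult = (*), one = 1, ring.zero = 0, ring.add = (+)\<rparr>"

lemma ring_free_ring: "ring (free_ring :: 'g free_alg ring)"
proof (rule ringI)
  show "abelian_group (free_ring :: 'g free_alg ring)"
  proof (rule abelian_groupI)
    fix x :: "'g free_alg"
    show "\<exists>y\<in>carrier free_ring. y \<oplus>\<^bsub>free_ring\<^esub> x = \<zero>\<^bsub>free_ring\<^esub>"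
      by (rule bexI [of _ "- x"]) (simp_all add: free_ring_def)
  qed (simp_all add: free_ring_def algebra_simps)
  show "monoid (free_ring :: 'g free_alg ring)"
    by (rule monoidI) (simp_all add: free_ring_def algebra_simps)
qed (simp_all add: free_ring_def algebra_simps)


subsection \<open>Presented algebras and their automorphism groups\<close>

text \<open>
  A unital associative complex algebra is represented by the record type
  \<^typ>\<open>(complex, 'b) module\<close>. The locale \<^locale>\<open>algebra\<close> of HOL-Algebra does not apply,
  since it only covers commutative algebras.
\<close>

definition presented_algebra :: "'g free_alg set \<Rightarrow> (complex, 'g free_alg set) module" where
  "presented_algebra S =
    (let I = genideal free_ring S in
     ring.extend (free_ring Quot I)
       (module.fields (\<lambda>c A. \<Union>x\<in>A. I +>\<^bsub>free_ring\<^esub> (scalar c * x))))"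

lemma ring_presented_algebra: "ring (presented_algebra S)"
proof -
  have i: "ideal (genideal free_ring S) free_ring"
    by (rule ring.genideal_ideal[OF ring_free_ring]) (simp add: free_ring_def)
  have r: "ring (free_ring Quot genideal free_ring S)"
    by (rule ideal.quotient_is_ring[OF i])
  interpret Q: ring "free_ring Quot genideal free_ring S" by (rule r)
  have eqs: "carrier (presented_algebra S) = carrier (free_ring Quot genideal free_ring S)"
    "monoid.mult (presented_algebra S) = monoid.mult (free_ring Quot genideal free_ring S)"
    "one (presented_algebra S) = one (free_ring Quot genideal free_ring S)"
    "ring.zero (presented_algebra S) = ring.zero (free_ring Quot genideal free_ring S)"
    "ring.add (presented_algebra S) = ring.add (free_ring Quot genideal free_ring S)"
    by (simp_all add: presented_algebra_def Let_def ring.defs)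
  show ?thesis
  proof (rule ringI)
    show "abelian_group (presented_algebra S)"
    proof (rule abelian_groupI, unfold eqs)
      fix x assume "x \<in> carrier (free_ring Quot genideal free_ring S)"
      then show "\<exists>y\<in>carrier (free_ring Quot genideal free_ring S).
          y \<oplus>\<^bsub>free_ring Quot genideal free_ring S\<^esub> x = \<zero>\<^bsub>free_ring Quot genideal free_ring S\<^esub>"
        using Q.l_neg Q.a_inv_closed by blast
    qed (fact Q.add.m_closed Q.zero_closed Q.add.m_assoc Q.add.m_comm Q.l_zero)+
    show "monoid (presented_algebra S)"
      by (rule monoidI, unfold eqs) (fact Q.m_closed Q.one_closed Q.m_assoc Q.l_one Q.r_one)+
  qed (unfold eqs, (fact Q.l_distr Q.r_distr)+)
qed

lemma smult_presented_algebra: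
  fixes S :: "'g free_alg set"
  defines "I \<equiv> genideal free_ring S"
  shows "c \<odot>\<^bsub>presented_algebra S\<^esub> (I +>\<^bsub>free_ring\<^esub> x) = I +>\<^bsub>free_ring\<^esub> (scalar c * x)"
proof -
  interpret R: ring "free_ring :: 'g free_alg ring" by (rule ring_free_ring)
  interpret I: ideal I "free_ring :: 'g free_alg ring"
    unfolding I_def by (rule R.genideal_ideal) (simp add: free_ring_def)
  have car: "\<And>y :: 'g free_alg. y \<in> carrier free_ring" by (simp add: free_ring_def)
  have "I +>\<^bsub>free_ring\<^esub> (scalar c * y) = I +>\<^bsub>free_ring\<^esub> (scalar c * x)"
    if "y \<in> I +>\<^bsub>free_ring\<^esub> x" for y
  proof -
    from that obtain h where h: "h \<in> I" "y = h + x"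
      by (auto simp: a_r_coset_def' free_ring_def)
    have "scalar c * h \<in> I"
      using I.I_l_closed[OF h(1) car[of "scalar c"]] by (simp add: free_ring_def)
    then have "scalar c * y \<in> I +>\<^bsub>free_ring\<^esub> (scalar c * x)"
      unfolding h(2) by (auto simp: a_r_coset_def' free_ring_def algebra_simps)
    then show ?thesis using I.a_repr_independence'[OF _ car] by simp
  qed
  moreover have "x \<in> I +>\<^bsub>free_ring\<^esub> x" using I.a_rcos_self[OF car] .
  ultimately have "(\<Union>y\<in>I +>\<^bsub>free_ring\<^esub> x. I +>\<^bsub>free_ring\<^esub> (scalar c * y)) =
      I +>\<^bsub>free_ring\<^esub> (scalar c * x)"
    by blast
  then show ?thesis
    unfolding presented_algebra_def Let_def I_def[symmetric] ring.defs module.defs by simp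
qed

definition alg_auto :: "(complex, 'b) module \<Rightarrow> ('b \<Rightarrow> 'b) set" where
  "alg_auto A =
    {f \<in> ring_hom A A \<inter> Bij (carrier A).
       \<forall>c. \<forall>x \<in> carrier A. f (c \<odot>\<^bsub>A\<^esub> x) = c \<odot>\<^bsub>A\<^esub> f x}"

definition AlgAutoGroup :: "(complex, 'b) module \<Rightarrow> ('b \<Rightarrow> 'b) monoid" where
  "AlgAutoGroup A = BijGroup (carrier A) \<lparr>carrier := alg_auto A\<rparr>"


subsection \<open>The Dynkin diagram of type $A_2$ and the positive part of the quantum group\<close>

datatype node = N1 | N2

definition dynkin_adj :: "node \<Rightarrow> node \<Rightarrow> bool" where
  "dynkin_adj i j \<longleftrightarrow> {i, j} = {N1, N2}"

definition autdiagr :: "(node \<Rightarrow> node) monoid" where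
  "autdiagr = BijGroup UNIV
     \<lparr>carrier := {w \<in> Bij UNIV. \<forall>i j. dynkin_adj (w i) (w j) \<longleftrightarrow> dynkin_adj i j}\<rparr>"

lemma carrier_autdiagr: "carrier autdiagr = Bij UNIV"
proof -
  have "inj w \<Longrightarrow> {w i, w j} = {N1,N2} \<longleftrightarrow> i \<noteq> j" for i j and w :: "node \<Rightarrow> node"
    using inj_eq[of w i j] by (cases "w i"; cases "w j") auto
  moreover have "{i, j} = {N1,N2} \<longleftrightarrow> i \<noteq> j" for i j by (cases i; cases j) auto
  ultimately show ?thesis by (auto simp: autdiagr_def dynkin_adj_def Bij_def bij_def)
qed

lemma group_autdiagr: "group autdiagr"
proof -
  have "autdiagr = BijGroup UNIV" using carrier_autdiagr by (simp add: autdiagr_def BijGroup_def)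
  then show ?thesis using group_BijGroup by metis
qed

definition serre :: "complex \<Rightarrow> node \<Rightarrow> node \<Rightarrow> node free_alg" where
  "serre q i j =
     gen i ^ 2 * gen j - scalar (q + inverse q) * gen i * gen j * gen i + gen j * gen i ^ 2"

definition Uq_plus_sl3 :: "complex \<Rightarrow> (complex, node free_alg set) module" where
  "Uq_plus_sl3 q = presented_algebra {serre q N1 N2, serre q N2 N1}"


subsection \<open>The semidirect product\<close>

definition semidirect_product ::
    "('a, 'c) monoid_scheme \<Rightarrow> ('b, 'd) monoid_scheme \<Rightarrow> ('b \<Rightarrow> 'a \<Rightarrow> 'a) \<Rightarrow> ('a \<times> 'b) monoid" where
  "semidirect_product G H act =
    \<lparr>carrier = carrier G \<times> carrier H,
     monoid.mult = (\<lambda>(g, h) (g', h'). (g \<otimes>\<^bsub>G\<^esub> act h g', h \<otimes>\<^bsub>H\<^esub> h')),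
     one = (\<one>\<^bsub>G\<^esub>, \<one>\<^bsub>H\<^esub>)\<rparr>"

definition Cstar :: "complex monoid" where
  "Cstar = \<lparr>carrier = UNIV - {0}, monoid.mult = (*), one = 1\<rparr>"

text \<open>The torus $(\mathbb{C}^*)^2$, with coordinates indexed by the two nodes.\<close>

definition torus :: "(node \<Rightarrow> complex) monoid" where
  "torus = product_group UNIV (\<lambda>_. Cstar)"

text \<open>
  Conjugating the algebra automorphism $E_i \mapsto \lambda_i E_i$ by $E_i \mapsto E_{w(i)}$
  gives $E_i \mapsto \lambda_{w^{-1}(i)} E_i$.
\<close>

definition diagr_act :: "(node \<Rightarrow> node) \<Rightarrow> (node \<Rightarrow> complex) \<Rightarrow> node \<Rightarrow> complex" where
  "diagr_act w l = (\<lambda>i. l (inv_into UNIV w i))"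

lemma group_torus: "group torus"
  unfolding torus_def by (rule product_group)
   (auto simp: Cstar_def intro!: groupI bexI[where x="inverse _"])

lemma carrier_torus: "carrier torus = {l. \<forall>i. l i \<noteq> 0}" by (auto simp: torus_def Cstar_def)

lemma group_semidirect_torus: "group (semidirect_product torus autdiagr diagr_act)" (is "group ?G")
proof -
  have ad: "autdiagr = BijGroup UNIV" using carrier_autdiagr by (simp add: autdiagr_def BijGroup_def)
  have restrict_UNIV: "restrict f UNIV = f" for f :: "node \<Rightarrow> 'z"
    by (simp add: restrict_def)
  have inv_ident: "inv_into UNIV (\<lambda>x::node. x) = (\<lambda>x. x)" by (simp add: inv_into_def fun_eq_iff)
  have car: "carrier ?G = {l. \<forall>i. l i \<noteq> 0} \<times> {w. bij w}"
    by (auto simp: semidirect_product_def carrier_torus carrier_autdiagr Bij_def)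
  have m: "(l,w) \<otimes>\<^bsub>?G\<^esub> (l',w') = (\<lambda>i. l i * l' (inv_into UNIV w i), w \<circ> w')" if "bij w" "bij w'" for l l' w w'
    using that by (simp add: semidirect_product_def torus_def Cstar_def diagr_act_def ad BijGroup_def Bij_def compose_def o_def restrict_UNIV)
  have o: "\<one>\<^bsub>?G\<^esub> = (\<lambda>i. 1, \<lambda>i. i)"
    by (simp add: semidirect_product_def torus_def Cstar_def ad BijGroup_def Bij_def restrict_UNIV)
  show ?thesis
  proof (rule groupI)
    fix x assume "x \<in> carrier ?G"
    then obtain l w where x: "x = (l,w)" "\<And>i. l i \<noteq> 0" "bij w" unfolding car by auto
    have "bij (inv_into UNIV w)" using x by (simp add: bij_imp_bij_inv)
    then show "\<exists>y\<in>carrier ?G. y \<otimes>\<^bsub>?G\<^esub> x = \<one>\<^bsub>?G\<^esub>"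
      using x by (intro bexI[where x="(\<lambda>i. inverse (l (w i)), inv_into UNIV w)"])
       (auto simp: m o car inv_inv_eq fun_eq_iff bij_is_inj)
  next
    fix x y assume "x \<in> carrier ?G" "y \<in> carrier ?G"
    then obtain l w l' w' where "x = (l, w)" "y = (l', w')" "\<And>i. l i \<noteq> 0" "\<And>i. l' i \<noteq> 0" "bij w" "bij w'"
      unfolding car by auto
    then show "x \<otimes>\<^bsub>?G\<^esub> y \<in> carrier ?G"
      unfolding car by (simp add: m bij_comp)
  next
    show "\<one>\<^bsub>?G\<^esub> \<in> carrier ?G"
      unfolding car o using bij_id by (simp add: id_def)
  next
    fix x y z assume "x \<in> carrier ?G" "y \<in> carrier ?G" "z \<in> carrier ?G"
    then obtain l w l' w' l'' w'' where *: "x = (l, w)" "y = (l', w')" "z = (l'', w'')" "bij w" "bij w'" "bij w''"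
      unfolding car by auto
    show "x \<otimes>\<^bsub>?G\<^esub> y \<otimes>\<^bsub>?G\<^esub> z = x \<otimes>\<^bsub>?G\<^esub> (y \<otimes>\<^bsub>?G\<^esub> z)"
      using *(4-6) unfolding *(1-3) by (simp add: m bij_comp comp_assoc o_inv_distrib mult.assoc)
  next
    fix x assume "x \<in> carrier ?G"
    then obtain l w where "x = (l, w)" "bij w" unfolding car by auto
    moreover have "bij (\<lambda>i::node. i)" using bij_id by (simp add: id_def)
    ultimately show "\<one>\<^bsub>?G\<^esub> \<otimes>\<^bsub>?G\<^esub> x = x"
      by (simp add: o m inv_ident comp_def)
  qed
qed

end

theory Submission
  imports Defs "HOL-Library.Function_Algebras" "HOL-Library.Product_Plus" "HOL-Library.Product_Lexorder"
begin

text \<open>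
  Write $x, y$ for the two generators and put $z = xy - q^{-1}yx$ and $z' = xy - q\,yx$. The Serre
  relations say $xz = q\,zx$ and $zy = q\,yz$; it follows that $xz' = q^{-1}z'x$, that $z$ and $z'$
  commute, and that $yx$ is a multiple of $z' - z$. Up to rescaling $z$ and $z'$, the algebra $A$
  therefore maps to the quantum torus spanned by the monomials $z^a z'^b x^k$ ($a, b \ge 0$,
  $k \in \mathbb{Z}$), with $y = (z' - z)x^{-1}$. This map is injective: the ordered monomials
  $y^i z^j x^k$ span $A$, and their images have distinct extremal terms (\<open>nf_eq_zero_iff\<close>).
  Inside the quantum torus everything is controlled by exponents.

  First, the exponents form an ordered group, so extremal exponents add under multiplication and every
  factor of a monomial is a monomial (\<open>supp_mult_singleton\<close>). Second, since $q$ is not a root of unity,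
  an element commuting with $x$ and $z$ is a polynomial in the central element $zz'$
  (\<open>central_supp\<close>). Third, a monomial that lies in $A$ has no negative power of $x$
  (\<open>monomial_nonneg\<close>).

  Let $\sigma$ be an automorphism. Every character of $A$ kills $z$ and $z'$, so $\sigma^{-1}(zz')$ is a
  central element without constant term, that is, a multiple of $zz'$. Applying $\sigma$ shows that
  $\sigma(zz')$ divides the monomial $zz'$; it is then itself a central monomial, and comparing exponents
  leaves only multiples of $zz'$ (\<open>supp_tau_central\<close>). From $\sigma(z)\sigma(z') = c\,zz'$ it follows that
  $\sigma(z)$ and $\sigma(z')$ are monomials, and the remaining possibilities are that $\sigma$ fixes or
  exchanges the lines of $z$ and $z'$ (\<open>supp_tau_root_vecs\<close>). The $q$-commutation relations with these
  two elements fix the power of $x$ in every term of $\sigma(x)$ and $\sigma(y)$, and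
  $\sigma(y)\sigma(x)$, being a combination of $z$ and $z'$, fixes their degrees. Only multiples of $x$
  and $y$ survive (\<open>tau_gens\<close>).
\<close>

section \<open>Modules over the free algebra\<close>

lemma scalar_zero [simp]: "scalar 0 = 0"
  and scalar_one [simp]: "scalar 1 = 1"
  by (simp_all add: scalar_def)

lemma scalar_add: "scalar (a + b) = scalar a + scalar b"
  by (simp add: scalar_def single_add)

lemma scalar_mult: "scalar (a * b) = scalar a * scalar b"
  by (simp add: scalar_def mult_single)

lemma scalar_uminus: "scalar (- a) = - scalar a"
  by (simp add: scalar_def single_uminus)

lemma single_add_induct [case_names single add]:
  fixes f :: "'a \<Rightarrow>\<^sub>0 'b::monoid_add"
  assumes "\<And>k c. P (Poly_Mapping.single k c)" and "\<And>f g. P f \<Longrightarrow> P g \<Longrightarrow> P (f + g)"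
  shows "P f"
proof (induction f rule: update_induct)
  case const
  show ?case using assms(1)[of undefined 0] by simp
next
  case (update f a b)
  have "Poly_Mapping.update a b f = Poly_Mapping.single a b + f"
    using update(1) by (intro poly_mapping_eqI) (auto simp: lookup_update lookup_add lookup_single when_def in_keys_iff)
  then show ?case using assms update by metis
qed

lemma scalar_commute: "scalar c * f = f * scalar c"
  by (induction f rule: single_add_induct) (simp_all add: scalar_def mult_single algebra_simps)

lemma scalar_left_commute: "f * (scalar c * g) = scalar c * (f * g)"
  by (metis mult.assoc scalar_commute)

lemma single_Word_Cons: "Poly_Mapping.single (Word (i # w)) c = gen i * Poly_Mapping.single (Word w) c"
  by (simp add: gen_def mult_single plus_word_def)

lemma free_alg_induct [case_names scalar gen_mult add]:
  assumes "\<And>c. P (scalar c)" and "\<And>i f. P f \<Longrightarrow> P (gen i * f)"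
    and "\<And>f g. P f \<Longrightarrow> P g \<Longrightarrow> P (f + g)"
  shows "P f"
proof (induction f rule: single_add_induct)
  case (single k c)
  have "P (Poly_Mapping.single (Word w) c)" for w
    by (induction w) (use assms(1)[of c] in \<open>simp_all add: scalar_def zero_word_def single_Word_Cons assms(2)\<close>)
  then show ?case by (cases k) simp
qed (rule assms(3))

text \<open>
  Giving the operators by which the generators act on a vector space is the same as giving a module over
  the free algebra. All representations needed below, and also the algebra homomorphisms out of the free
  algebra, arise in this way.
\<close>

locale free_action =
  fixes sc :: "complex \<Rightarrow> 'v::ab_group_add \<Rightarrow> 'v" and op :: "'g \<Rightarrow> 'v \<Rightarrow> 'v"
  assumes sc_add_left: "sc (a + b) v = sc a v + sc b v"
    and sc_add_right: "sc a (v + w) = sc a v + sc a w"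
    and sc_sc: "sc a (sc b v) = sc (a * b) v"
    and sc_one: "sc 1 v = v"
    and op_add: "op i (v + w) = op i v + op i w"
    and op_sc: "op i (sc a v) = sc a (op i v)"
begin

definition act :: "'g free_alg \<Rightarrow> 'v \<Rightarrow> 'v" where
  "act f v = (\<Sum>w\<in>Poly_Mapping.keys f. sc (Poly_Mapping.lookup f w) (foldr op (letters w) v))"

lemma sc_zero_left: "sc 0 v = 0"
  using sc_add_left[of 0 0 v] by simp

lemma act_single: "act (Poly_Mapping.single w c) v = sc c (foldr op (letters w) v)"
  by (cases "c = 0") (simp_all add: act_def sc_zero_left)

lemma act_add_left: "act (f + g) v = act f v + act g v"
  unfolding act_def by (rule setsum_keys_plus_distrib) (simp_all add: sc_zero_left sc_add_left)

lemma act_scalar: "act (scalar c) v = sc c v"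
  by (simp add: scalar_def act_single zero_word_def)

lemma act_one: "act 1 v = v"
  using act_scalar[of 1 v] by (simp add: sc_one)

lemma act_gen: "act (gen i) v = op i v"
  by (simp add: gen_def act_single sc_one)

lemma act_scalar_mult: "act (scalar c * f) v = sc c (act f v)"
  by (induction f rule: single_add_induct)
    (simp_all add: scalar_def mult_single act_single sc_sc act_add_left sc_add_right distrib_left)

lemma act_gen_mult: "act (gen i * f) v = op i (act f v)"
proof (induction f rule: single_add_induct)
  case (single k c)
  then show ?case
    by (cases k) (simp add: gen_def mult_single plus_word_def act_single op_sc)
qed (simp add: distrib_left act_add_left op_add)

lemma act_mult: "act (f * g) v = act f (act g v)"
  by (induction f rule: free_alg_induct)
    (simp_all add: act_scalar_mult act_scalar mult.assoc act_gen_mult distrib_right act_add_left)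

lemma act_zero_left: "act 0 v = 0"
  using act_add_left[of 0 0 v] by simp

lemma act_uminus_left: "act (- f) v = - act f v"
  using act_add_left[of f "- f" v] by (simp add: act_zero_left add_eq_0_iff)

lemma act_diff_left: "act (f - g) v = act f v - act g v"
  using act_add_left[of f "- g" v] by (simp add: act_uminus_left)

lemma act_sum_left: "act (sum F J) v = (\<Sum>x\<in>J. act (F x) v)"
  by (induction J rule: infinite_finite_induct) (simp_all add: act_zero_left act_add_left)

lemma act_add_right: "act f (v + w) = act f v + act f w"
  by (induction f rule: free_alg_induct)
    (simp_all add: act_scalar sc_add_right act_gen_mult op_add act_add_left)

lemma act_sc_right: "act f (sc c v) = sc c (act f v)"
  by (induction f rule: free_alg_induct)
    (simp_all add: act_scalar sc_sc mult.commute act_gen_mult op_sc act_add_left sc_add_right)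

lemma act_zero_right: "act f 0 = 0"
  using act_add_right[of f 0 0] by simp

lemma act_sum_right: "act f (sum F J) = (\<Sum>x\<in>J. act f (F x))"
  by (induction J rule: infinite_finite_induct) (simp_all add: act_zero_right act_add_right)

text \<open>
  A linear map commuting with the generators is a module homomorphism. Applied to right multiplications,
  this replaces an explicit multiplication in the quantum torus.
\<close>

lemma act_intertwine:
  assumes "\<And>v w. R (v + w) = R v + R w" "\<And>c v. R (sc c v) = sc c (R v)"
    and "\<And>i v. R (op i v) = op i (R v)"
  shows "R (act f v) = act f (R v)"
  by (induction f rule: free_alg_induct) (simp_all add: act_scalar act_gen_mult act_add_left assms)

lemma act_invariant:
  assumes "v \<in> N" "\<And>a w. w \<in> N \<Longrightarrow> sc a w \<in> N" "\<And>u w. u \<in> N \<Longrightarrow> w \<in> N \<Longrightarrow> u + w \<in> N"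
    and "\<And>i w. w \<in> N \<Longrightarrow> op i w \<in> N"
  shows "act f v \<in> N"
  by (induction f rule: free_alg_induct) (simp_all add: act_scalar act_gen_mult act_add_left assms)

end

text \<open>
  With the generators acting by left multiplication by chosen elements, the orbit map of $1$ is the
  homomorphism of free algebras that sends the generators to these elements.
\<close>

interpretation subst: free_action "\<lambda>c v. scalar c * v" "\<lambda>i v. h i * v"
  for h :: "'g \<Rightarrow> 'h free_alg"
  by unfold_locales (simp_all add: scalar_add scalar_mult distrib_left distrib_right mult.assoc, metis mult.assoc scalar_commute)

section \<open>Two representations\<close>

definition fscale :: "complex \<Rightarrow> ('a \<Rightarrow> complex) \<Rightarrow> 'a \<Rightarrow> complex" where
  "fscale c v = (\<lambda>p. c * v p)"

text \<open>
  The quantum torus, as the left regular representation on coefficient functions. The exponent $(d, a, k)$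
  stands for the monomial $z^a z'^{d-a} x^k$, rescaled so that $y = (z' - z)x^{-1}$. The total
  degree $d$ in $z$ and $z'$ comes first so that the lexicographic order refines the degree.
\<close>

fun torus_op :: "complex \<Rightarrow> node \<Rightarrow> (int \<times> int \<times> int \<Rightarrow> complex)
    \<Rightarrow> int \<times> int \<times> int \<Rightarrow> complex" where
  "torus_op q N1 v = (\<lambda>(d, a, k). q powi (2 * a - d) * v (d, a, k - 1))"
| "torus_op q N2 v = (\<lambda>(d, a, k). q powi (d - 2 * a - 1) * v (d - 1, a, k + 1)
     - q powi (d - 2 * a + 1) * v (d - 1, a - 1, k + 1))"

text \<open>
  A $q$-oscillator representation with basis $e_k$ ($k \in \mathbb{Z}$): $x e_k = e_{k+1}$ and
  $y e_k = (q^k - q^{-k}) e_{k-1}$. Because $y e_0 = 0$, the vectors $e_k$ with $k \ge 0$ span a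
  submodule, which is what detects negative powers of $x$.
\<close>

fun fock_op :: "complex \<Rightarrow> node \<Rightarrow> (int \<Rightarrow> complex) \<Rightarrow> int \<Rightarrow> complex" where
  "fock_op q N1 u = (\<lambda>k. u (k - 1))"
| "fock_op q N2 u = (\<lambda>k. (q powi (k + 1) - q powi (- k - 1)) * u (k + 1))"

lemma fun_sum_apply: "(\<Sum>m\<in>M. F m) p = (\<Sum>m\<in>M. F m p)"
  for F :: "'b \<Rightarrow> 'a \<Rightarrow> 'c::comm_monoid_add"
  by (induction M rule: infinite_finite_induct) auto

definition delta :: "'a \<Rightarrow> 'a \<Rightarrow> complex" where
  "delta m = (\<lambda>p. if p = m then 1 else 0)"

section \<open>The Serre ideal and its representations\<close>

lemma free_ring_idealI:
  fixes J :: "'g free_alg set"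
  assumes "0 \<in> J" "\<And>f g. f \<in> J \<Longrightarrow> g \<in> J \<Longrightarrow> f + g \<in> J"
    and "\<And>f g. g \<in> J \<Longrightarrow> f * g \<in> J" "\<And>f g. f \<in> J \<Longrightarrow> f * g \<in> J"
  shows "ideal J free_ring"
proof (rule idealI)
  show "ring (free_ring :: 'g free_alg ring)" by (rule ring_free_ring)
  interpret R: ring "free_ring :: 'g free_alg ring" by (rule ring_free_ring)
  have inv: "\<ominus>\<^bsub>free_ring\<^esub> f = - f" for f :: "'g free_alg"
    by (rule R.minus_equality) (simp_all add: free_ring_def)
  show "subgroup J (add_monoid (free_ring :: 'g free_alg ring))"
  proof (rule R.add.subgroupI)
    fix f assume "f \<in> J"
    then show "\<ominus>\<^bsub>free_ring\<^esub> f \<in> J" using assms(3)[of f "-1"] by (simp add: inv)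
  qed (use assms in \<open>auto simp: free_ring_def\<close>)
qed (use assms in \<open>auto simp: free_ring_def\<close>)

definition serre_ideal :: "complex \<Rightarrow> node free_alg set" where
  "serre_ideal q = genideal free_ring {serre q N1 N2, serre q N2 N1}"

lemma ideal_serre_ideal: "ideal (serre_ideal q) free_ring"
  unfolding serre_ideal_def
  by (rule ring.genideal_ideal[OF ring_free_ring]) (simp add: free_ring_def)

lemma serre_ideal_zero: "0 \<in> serre_ideal q"
  using additive_subgroup.zero_closed[OF ideal.axioms(1)[OF ideal_serre_ideal]]
  by (simp add: free_ring_def)

lemma serre_ideal_add: "f \<in> serre_ideal q \<Longrightarrow> g \<in> serre_ideal q \<Longrightarrow> f + g \<in> serre_ideal q"
  using additive_subgroup.a_closed[OF ideal.axioms(1)[OF ideal_serre_ideal]]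
  by (simp add: free_ring_def)

lemma serre_ideal_mult_left: "g \<in> serre_ideal q \<Longrightarrow> f * g \<in> serre_ideal q"
  using ideal.I_l_closed[OF ideal_serre_ideal, of g q f] by (simp add: free_ring_def)

lemma serre_ideal_mult_right: "f \<in> serre_ideal q \<Longrightarrow> f * g \<in> serre_ideal q"
  using ideal.I_r_closed[OF ideal_serre_ideal, of f q g] by (simp add: free_ring_def)

lemma serre_mem_serre_ideal: "serre q N1 N2 \<in> serre_ideal q" "serre q N2 N1 \<in> serre_ideal q"
  using ring.genideal_self[OF ring_free_ring, of "{serre q N1 N2, serre q N2 N1}"]
  by (auto simp: serre_ideal_def free_ring_def)

lemma serre_ideal_minimal:
  assumes "ideal J free_ring" "serre q N1 N2 \<in> J" "serre q N2 N1 \<in> J"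
  shows "serre_ideal q \<subseteq> J"
  unfolding serre_ideal_def
  by (rule ring.genideal_minimal[OF ring_free_ring assms(1)]) (use assms in auto)

definition serre_cong :: "complex \<Rightarrow> node free_alg \<Rightarrow> node free_alg \<Rightarrow> bool" where
  "serre_cong q f g \<longleftrightarrow> f - g \<in> serre_ideal q"

lemma serre_ideal_uminus: "f \<in> serre_ideal q \<Longrightarrow> - f \<in> serre_ideal q"
  using serre_ideal_mult_left[of f q "-1"] by simp

lemma serre_cong_refl [simp]: "serre_cong q f f"
  by (simp add: serre_cong_def serre_ideal_zero)

lemma serre_cong_sym: "serre_cong q f g \<Longrightarrow> serre_cong q g f"
  using serre_ideal_uminus[of "f - g" q] by (simp add: serre_cong_def)

lemma serre_cong_trans [trans]: "serre_cong q f g \<Longrightarrow> serre_cong q g h \<Longrightarrow> serre_cong q f h"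
  using serre_ideal_add[of "f - g" q "g - h"] by (simp add: serre_cong_def)

lemma serre_cong_add: "serre_cong q f f' \<Longrightarrow> serre_cong q g g' \<Longrightarrow> serre_cong q (f + g) (f' + g')"
  using serre_ideal_add[of "f - f'" q "g - g'"] by (simp add: serre_cong_def algebra_simps)

lemma serre_cong_mult:
  assumes "serre_cong q f f'" "serre_cong q g g'"
  shows "serre_cong q (f * g) (f' * g')"
  using serre_ideal_add[OF serre_ideal_mult_right[of "f - f'" q g] serre_ideal_mult_left[of "g - g'" q f']] assms
  by (simp add: serre_cong_def algebra_simps)

lemma serre_cong_mult_left: "serre_cong q f f' \<Longrightarrow> serre_cong q (g * f) (g * f')"
  by (simp add: serre_cong_mult)

lemma serre_cong_mult_right: "serre_cong q f f' \<Longrightarrow> serre_cong q (f * g) (f' * g)"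
  by (simp add: serre_cong_mult)

text \<open>
  For $t = q^{-1}$ and $t = q$ these are the two quantum root vectors of weight $\alpha_1 + \alpha_2$.
\<close>

definition root_vec :: "complex \<Rightarrow> node free_alg" where
  "root_vec t = gen N1 * gen N2 - scalar t * (gen N2 * gen N1)"

locale generic_q =
  fixes q :: complex
  assumes q_nonzero: "q \<noteq> 0" and q_not_root_of_unity: "\<forall>n::nat. 0 < n \<longrightarrow> q ^ n \<noteq> 1"
begin

lemma powi_q_eq_1_iff: "q powi n = 1 \<longleftrightarrow> n = 0"
proof
  assume *: "q powi n = 1"
  then have "q powi (- n) = 1" by (simp add: power_int_minus)
  with * have "q powi \<bar>n\<bar> = 1" by (cases "n \<ge> 0") auto
  then have "q ^ nat \<bar>n\<bar> = 1" by (simp add: power_int_def)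
  then show "n = 0" using q_not_root_of_unity by (cases "nat \<bar>n\<bar> = 0") auto
qed simp

abbreviation x :: "node free_alg" where "x \<equiv> gen N1"
abbreviation y :: "node free_alg" where "y \<equiv> gen N2"
abbreviation z :: "node free_alg" where "z \<equiv> root_vec (inverse q)"
abbreviation z' :: "node free_alg" where "z' \<equiv> root_vec q"
abbreviation s :: complex where "s \<equiv> inverse q - q"
abbreviation cong_A (infix \<open>\<asymp>\<close> 50) where "f \<asymp> g \<equiv> serre_cong q f g"

lemma s_nonzero: "s \<noteq> 0"
proof
  assume "s = 0"
  then have "q ^ 2 = 1" using q_nonzero by (simp add: field_simps power2_eq_square)
  then show False using q_not_root_of_unity by (metis zero_less_numeral)
qed

text \<open>
  In terms of $z$, the cubic Serre relations become $q$-commutation relations.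
\<close>

lemma serre_N1_N2: "serre q N1 N2 = x * z - scalar q * z * x"
proof -
  have "scalar q * scalar (inverse q) = (1 :: node free_alg)"
    using q_nonzero by (simp flip: scalar_mult)
  then have "scalar q * (scalar (inverse q) * f) = f" for f :: "node free_alg"
    by (simp flip: mult.assoc)
  then show ?thesis
    by (simp add: serre_def root_vec_def power2_eq_square algebra_simps scalar_add
        scalar_left_commute[of x])
qed

lemma serre_N2_N1: "serre q N2 N1 = z * y - scalar q * y * z"
proof -
  have "scalar q * scalar (inverse q) = (1 :: node free_alg)"
    using q_nonzero by (simp flip: scalar_mult)
  then have "scalar q * (scalar (inverse q) * f) = f" for f :: "node free_alg"
    by (simp flip: mult.assoc)
  then show ?thesis
    by (simp add: serre_def root_vec_def power2_eq_square algebra_simps scalar_add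
        scalar_left_commute[of y])
qed

lemma x_z: "x * z \<asymp> scalar q * z * x"
  using serre_mem_serre_ideal(1)[of q] by (simp add: serre_cong_def serre_N1_N2)

lemma z_y: "z * y \<asymp> scalar q * y * z"
  using serre_mem_serre_ideal(2)[of q] by (simp add: serre_cong_def serre_N2_N1)

sublocale T: free_action fscale "torus_op q"
proof
  fix i a and v w :: "int \<times> int \<times> int \<Rightarrow> complex"
  show "torus_op q i (v + w) = torus_op q i v + torus_op q i w"
    and "torus_op q i (fscale a v) = fscale a (torus_op q i v)"
    by (cases i; simp add: fun_eq_iff fscale_def algebra_simps)+
qed (simp_all add: fscale_def fun_eq_iff algebra_simps)

sublocale W: free_action fscale "fock_op q"
proof
  fix i a and v w :: "int \<Rightarrow> complex"
  show "fock_op q i (v + w) = fock_op q i v + fock_op q i w"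
    and "fock_op q i (fscale a v) = fscale a (fock_op q i v)"
    by (cases i; simp add: fun_eq_iff fscale_def algebra_simps)+
qed (simp_all add: fscale_def fun_eq_iff algebra_simps)

lemma T_root_vec:
  "T.act (root_vec t) v (d, a, k) =
     (inverse q - t) * v (d - 1, a, k) - (q - t) * v (d - 1, a - 1, k)"
  by (simp add: root_vec_def T.act_diff_left T.act_gen_mult T.act_gen T.act_scalar_mult
      T.act_mult T.act_scalar fscale_def power_int_add power_int_diff q_nonzero field_simps power2_eq_square)

lemma T_z: "T.act z v (d, a, k) = s * v (d - 1, a - 1, k)"
  and T_z': "T.act z' v (d, a, k) = s * v (d - 1, a, k)"
  by (simp_all add: T_root_vec algebra_simps)

lemma T_x: "T.act x v (d, a, k) = q powi (2 * a - d) * v (d, a, k - 1)"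
  and T_y: "T.act y v (d, a, k) = q powi (d - 2 * a - 1) * v (d - 1, a, k + 1)
     - q powi (d - 2 * a + 1) * v (d - 1, a - 1, k + 1)"
  by (simp_all add: T.act_gen)

lemma W_x: "W.act x u k = u (k - 1)"
  and W_y: "W.act y u k = (q powi (k + 1) - q powi (- k - 1)) * u (k + 1)"
  by (simp_all add: W.act_gen)

lemma W_root_vec:
  "W.act (root_vec t) u k = (q powi k * (1 - t * q) - q powi (- k) * (1 - t * inverse q)) * u k"
  by (simp add: root_vec_def W.act_diff_left W.act_mult W_x W_y W.act_scalar fscale_def
      power_int_add power_int_diff q_nonzero field_simps)

lemma W_z: "W.act z u k = s * q powi (- k - 1) * u k"
  and W_z': "W.act z' u k = s * q powi (k + 1) * u k"
  using q_nonzero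
  by (simp_all add: W_root_vec power_int_add power_int_diff power_int_minus field_simps power2_eq_square)

text \<open>
  The vectors killed by all elements of the ideal would only give a left annihilator; quantifying over all
  vectors makes the annihilator two-sided, so that it is enough to test the two Serre elements.
\<close>

lemma T_serre_ideal:
  assumes "f \<in> serre_ideal q"
  shows "T.act f v = 0"
proof -
  have 1: "T.act (serre q N1 N2) v = 0" for v
    by (simp add: fun_eq_iff serre_N1_N2 T.act_diff_left T.act_mult T.act_scalar T_x T_z fscale_def,
        simp add: power_int_add power_int_diff q_nonzero field_simps)
  have 2: "T.act (serre q N2 N1) v = 0" for v
    by (simp add: fun_eq_iff serre_N2_N1 T.act_diff_left T.act_mult T.act_scalar T_y T_z fscale_def,
        simp add: power_int_add power_int_diff q_nonzero field_simps power2_eq_square)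
  have "ideal {f. \<forall>v. T.act f v = 0} free_ring"
    by (rule free_ring_idealI) (auto simp: T.act_zero_left T.act_add_left T.act_mult T.act_zero_right)
  from serre_ideal_minimal[OF this, of q] show ?thesis using assms 1 2 by blast
qed

lemma W_serre_ideal:
  assumes "f \<in> serre_ideal q"
  shows "W.act f v = 0"
proof -
  have 1: "W.act (serre q N1 N2) v = 0" for v
    by (simp add: fun_eq_iff serre_N1_N2 W.act_diff_left W.act_mult W.act_scalar W_x W_z fscale_def,
        simp add: power_int_add power_int_diff q_nonzero field_simps)
  have 2: "W.act (serre q N2 N1) v = 0" for v
    by (simp add: fun_eq_iff serre_N2_N1 W.act_diff_left W.act_mult W.act_scalar W_y W_z fscale_def,
        simp add: power_int_add power_int_diff power_int_minus q_nonzero field_simps power2_eq_square)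
  have "ideal {f. \<forall>v. W.act f v = 0} free_ring"
    by (rule free_ring_idealI) (auto simp: W.act_zero_left W.act_add_left W.act_mult W.act_zero_right)
  from serre_ideal_minimal[OF this, of q] show ?thesis using assms 1 2 by blast
qed

lemma T_cong: "f \<asymp> g \<Longrightarrow> T.act f v = T.act g v"
  using T_serre_ideal[of "f - g" v] by (simp add: serre_cong_def T.act_diff_left)

lemma W_cong: "f \<asymp> g \<Longrightarrow> W.act f v = W.act g v"
  using W_serre_ideal[of "f - g" v] by (simp add: serre_cong_def W.act_diff_left)

section \<open>The Poincare-Birkhoff-Witt basis and faithfulness\<close>

lemma q_commute_power:
  assumes "a * b \<asymp> scalar c * b * a"
  shows "a * b ^ n \<asymp> scalar (c ^ n) * b ^ n * a"
proof (induction n)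
  case (Suc n)
  have "a * b ^ Suc n = a * b * b ^ n" by (simp add: mult.assoc)
  also have "\<dots> \<asymp> scalar c * b * a * b ^ n" by (rule serre_cong_mult_right[OF assms])
  also have "\<dots> = scalar c * b * (a * b ^ n)" by (simp add: mult.assoc)
  also have "\<dots> \<asymp> scalar c * b * (scalar (c ^ n) * b ^ n * a)"
    by (rule serre_cong_mult_left[OF Suc])
  also have "\<dots> = scalar (c ^ Suc n) * b ^ Suc n * a"
    by (simp add: scalar_mult mult.assoc scalar_left_commute[of b])
  finally show ?case .
qed simp

fun pbw :: "nat \<times> nat \<times> nat \<Rightarrow> node free_alg" where
  "pbw (i, j, k) = y ^ i * z ^ j * x ^ k"

definition pbw_comb :: "(nat \<times> nat \<times> nat \<Rightarrow>\<^sub>0 complex) \<Rightarrow> node free_alg" where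
  "pbw_comb c = (\<Sum>m\<in>Poly_Mapping.keys c. scalar (Poly_Mapping.lookup c m) * pbw m)"

lemma pbw_comb_single: "pbw_comb (Poly_Mapping.single m a) = scalar a * pbw m"
  by (cases "a = 0") (simp_all add: pbw_comb_def)

lemma pbw_comb_add: "pbw_comb (c + c') = pbw_comb c + pbw_comb c'"
  unfolding pbw_comb_def
  by (rule setsum_keys_plus_distrib) (simp_all add: scalar_add distrib_right)

definition pbw_span :: "node free_alg set" where
  "pbw_span = {f. \<exists>c. f \<asymp> pbw_comb c}"

lemma pbw_span_cong: "f \<asymp> g \<Longrightarrow> g \<in> pbw_span \<Longrightarrow> f \<in> pbw_span"
  by (auto simp: pbw_span_def intro: serre_cong_trans)

lemma pbw_span_add: "f \<in> pbw_span \<Longrightarrow> g \<in> pbw_span \<Longrightarrow> f + g \<in> pbw_span"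
proof -
  assume "f \<in> pbw_span" "g \<in> pbw_span"
  then obtain c d where "f \<asymp> pbw_comb c" "g \<asymp> pbw_comb d" by (auto simp: pbw_span_def)
  then have "f + g \<asymp> pbw_comb (c + d)" unfolding pbw_comb_add by (rule serre_cong_add)
  then show ?thesis by (auto simp: pbw_span_def)
qed

lemma pbw_span_scalar_pbw: "scalar a * pbw m \<in> pbw_span"
proof -
  have "scalar a * pbw m \<asymp> pbw_comb (Poly_Mapping.single m a)" by (simp add: pbw_comb_single)
  then show ?thesis unfolding pbw_span_def by blast
qed

lemma pbw_span_scalar: "f \<in> pbw_span \<Longrightarrow> scalar a * f \<in> pbw_span"
proof -
  have "scalar a * pbw_comb c \<in> pbw_span" for c
    by (induction c rule: single_add_induct)
      (simp_all add: pbw_comb_single pbw_comb_add distrib_left pbw_span_add pbw_span_scalar_pbw flip: mult.assoc scalar_mult)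
  moreover assume "f \<in> pbw_span"
  then obtain c where "f \<asymp> pbw_comb c" by (auto simp: pbw_span_def)
  ultimately show ?thesis using serre_cong_mult_left pbw_span_cong by blast
qed

lemma pbw_span_mult_left:
  assumes "\<And>m. g * pbw m \<in> pbw_span" and "f \<in> pbw_span"
  shows "g * f \<in> pbw_span"
proof -
  have "g * pbw_comb c \<in> pbw_span" for c
  proof (induction c rule: single_add_induct)
    case (single m a)
    show ?case using pbw_span_scalar[OF assms(1)] by (simp add: pbw_comb_single scalar_left_commute[of g])
  qed (simp add: pbw_comb_add distrib_left pbw_span_add)
  moreover obtain c where "f \<asymp> pbw_comb c" using assms(2) by (auto simp: pbw_span_def)
  ultimately show ?thesis using serre_cong_mult_left pbw_span_cong by blast
qed

lemma pbw_mem_span: "pbw m \<in> pbw_span"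
  using pbw_span_scalar_pbw[of 1 m] by simp

lemma pbw_span_y: "f \<in> pbw_span \<Longrightarrow> y * f \<in> pbw_span"
proof (rule pbw_span_mult_left)
  fix m :: "nat \<times> nat \<times> nat"
  obtain i j k where "m = (i, j, k)" by (cases m)
  then have "y * pbw m = pbw (Suc i, j, k)" by (simp add: mult.assoc)
  then show "y * pbw m \<in> pbw_span" using pbw_mem_span by metis
qed

text \<open>
  Moving $x$ to the right past $y$ creates a $z$, which $q$-commutes with $y$ and goes to its place.
  Together with closure under left multiplication by $y$ this makes the span a left ideal containing $1$.
\<close>

lemma pbw_span_x: "f \<in> pbw_span \<Longrightarrow> x * f \<in> pbw_span"
proof (rule pbw_span_mult_left)
  have "x * pbw (i, j, k) \<in> pbw_span" for i j k
  proof (induction i)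
    case 0
    have "x * pbw (0, j, k) = x * z ^ j * x ^ k" by (simp add: mult.assoc)
    also have "\<dots> \<asymp> scalar (q ^ j) * z ^ j * x * x ^ k"
      by (rule serre_cong_mult_right[OF q_commute_power[OF x_z]])
    also have "\<dots> = scalar (q ^ j) * pbw (0, j, Suc k)" by (simp add: mult.assoc)
    finally show ?case using pbw_span_cong pbw_span_scalar_pbw by blast
  next
    case (Suc i)
    have eq: "x * pbw (Suc i, j, k) = z * y ^ i * z ^ j * x ^ k
        + scalar (inverse q) * (y * (x * pbw (i, j, k)))"
      by (simp add: root_vec_def algebra_simps)
    have "z * y ^ i * z ^ j * x ^ k \<asymp> scalar (q ^ i) * y ^ i * z * z ^ j * x ^ k"
      by (intro serre_cong_mult_right q_commute_power z_y)
    also have "\<dots> = scalar (q ^ i) * pbw (i, Suc j, k)" by (simp add: mult.assoc)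
    finally have "z * y ^ i * z ^ j * x ^ k \<in> pbw_span"
      using pbw_span_cong pbw_span_scalar_pbw by blast
    then have "z * y ^ i * z ^ j * x ^ k + scalar (inverse q) * (y * (x * pbw (i, j, k))) \<in> pbw_span"
      by (rule pbw_span_add[OF _ pbw_span_scalar[OF pbw_span_y[OF Suc]]])
    then show ?case unfolding eq .
  qed
  then show "x * pbw m \<in> pbw_span" for m by (cases m) metis
qed

lemma pbw_spans: "f \<in> pbw_span"
proof (induction f rule: free_alg_induct)
  case (scalar c)
  then show ?case using pbw_span_scalar_pbw[of c "(0, 0, 0)"] by simp
next
  case (gen_mult i f)
  then show ?case using pbw_span_x pbw_span_y by (cases i) auto
qed (rule pbw_span_add)

text \<open>
  The image in the quantum torus, as a function on exponents. It turns out to be a normal form: it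
  determines an element of the free algebra modulo the Serre relations.
\<close>

definition nf :: "node free_alg \<Rightarrow> int \<times> int \<times> int \<Rightarrow> complex" where
  "nf f = T.act f (delta (0, 0, 0))"

lemma nf_add: "nf (f + g) = nf f + nf g"
  and nf_diff: "nf (f - g) = nf f - nf g"
  and nf_mult: "nf (f * g) = T.act f (nf g)"
  and nf_scalar: "nf (scalar c) m = (if m = (0, 0, 0) then c else 0)"
  and nf_scalar_mult: "nf (scalar c * f) m = c * nf f m"
  and nf_zero: "nf 0 = 0"
  by (simp_all add: nf_def T.act_add_left T.act_diff_left T.act_mult T.act_scalar T.act_zero_left fscale_def delta_def)

lemma T_z_power: "T.act (z ^ j) v (d, a, k) = s ^ j * v (d - int j, a - int j, k)"
  by (induction j arbitrary: v d a) (simp_all add: T.act_one T.act_mult T_z algebra_simps)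

lemma nf_x_power: "nf (x ^ k) = delta (0, 0, int k)"
  by (induction k) (auto simp: nf_def T.act_one T.act_mult fun_eq_iff T_x delta_def)

lemma nf_z_x_power: "nf (z ^ j * x ^ k) m = s ^ j * delta (int j, int j, int k) m"
  by (cases m) (auto simp: nf_mult nf_x_power T_z_power delta_def)

text \<open>
  Taking the summand $z'$ of $z' - z$ in each factor $y = (z' - z)x^{-1}$ gives the term of
  $y^i z^j x^k$ with the least power of $z$, and the exponent of this term determines $(i, j, k)$.
\<close>

lemma nf_pbw:
  "nf (pbw (i, j, k)) (d, a, n) \<noteq> 0 \<Longrightarrow> d = int i + int j \<and> n = int k - int i \<and> int j \<le> a"
  "nf (pbw (i, j, k)) (int i + int j, int j, int k - int i) \<noteq> 0"
proof (induction i arbitrary: d a n)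
  case 0
  {
    case 1 then show ?case by (auto simp: nf_z_x_power delta_def split: if_splits)
  next
    case 2 then show ?case using s_nonzero by (auto simp: nf_z_x_power delta_def)
  }
next
  case (Suc i)
  have step: "nf (pbw (Suc i, j, k)) (d, a, n) = q powi (d - 2 * a - 1) * nf (pbw (i, j, k)) (d - 1, a, n + 1)
     - q powi (d - 2 * a + 1) * nf (pbw (i, j, k)) (d - 1, a - 1, n + 1)" for d a n
    by (simp add: nf_mult T.act_mult T_y del: torus_op.simps)
  {
    case 1
    then have "nf (pbw (i, j, k)) (d - 1, a, n + 1) \<noteq> 0 \<or> nf (pbw (i, j, k)) (d - 1, a - 1, n + 1) \<noteq> 0"
      unfolding step by auto
    then show ?case using Suc.IH(1) by force
  next
    case 2
    have "nf (pbw (i, j, k)) (int i + int j, int j - 1, int k - int i) = 0"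
      using Suc.IH(1)[of "int i + int j" "int j - 1" "int k - int i"] by auto
    then show ?case unfolding step using Suc.IH(2) q_nonzero by (simp add: algebra_simps)
  }
qed

text \<open>
  Linear independence of the ordered monomials: in a nontrivial combination, choose a term
  $y^i z^j x^k$ with $j$ minimal. No other term contributes to the exponent of $z^j z'^i x^{k-i}$.
\<close>

lemma nf_eq_zero_iff: "nf f = 0 \<longleftrightarrow> f \<asymp> 0"
proof
  assume "nf f = 0"
  obtain c where c: "f \<asymp> pbw_comb c" using pbw_spans[of f] by (auto simp: pbw_span_def)
  have nf_comb: "nf (pbw_comb c) p = (\<Sum>m\<in>Poly_Mapping.keys c. Poly_Mapping.lookup c m * nf (pbw m) p)" for p
  proof -
    have "nf (pbw_comb c) = (\<Sum>m\<in>Poly_Mapping.keys c. fscale (Poly_Mapping.lookup c m) (nf (pbw m)))"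
      by (simp add: nf_def pbw_comb_def T.act_sum_left T.act_scalar_mult)
    then show ?thesis by (simp add: fun_sum_apply fscale_def)
  qed
  have "c = 0"
  proof (rule ccontr)
    assume "c \<noteq> 0"
    then have "Poly_Mapping.keys c \<noteq> {}" by simp
    define m where "m = arg_min_on (fst \<circ> snd) (Poly_Mapping.keys c)"
    have m: "m \<in> Poly_Mapping.keys c"
      unfolding m_def by (rule arg_min_if_finite) (use \<open>Poly_Mapping.keys c \<noteq> {}\<close> in simp_all)
    have m_least: "fst (snd m) \<le> fst (snd m')" if "m' \<in> Poly_Mapping.keys c" for m'
      using arg_min_least[OF finite_keys _ that, of "fst \<circ> snd"] \<open>Poly_Mapping.keys c \<noteq> {}\<close> by (simp add: m_def)
    obtain i j k where ijk: "m = (i, j, k)" by (cases m)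
    let ?p = "(int i + int j, int j, int k - int i)"
    have "nf (pbw m') ?p = 0" if "m' \<in> Poly_Mapping.keys c - {m}" for m'
    proof (rule ccontr)
      assume *: "nf (pbw m') ?p \<noteq> 0"
      obtain i' j' k' where m': "m' = (i', j', k')" by (cases m')
      have "int i + int j = int i' + int j' \<and> int k - int i = int k' - int i' \<and> int j' \<le> int j"
        by (rule nf_pbw(1)) (use * in \<open>simp only: m' not_False_eq_True\<close>)
      moreover have "j \<le> j'" using m_least[of m'] that m' ijk by simp
      ultimately have "m' = m" unfolding m' ijk by simp
      then show False using that by simp
    qed
    then have "(\<Sum>m'\<in>Poly_Mapping.keys c - {m}. Poly_Mapping.lookup c m' * nf (pbw m') ?p) = 0"
      by (intro sum.neutral) simp
    then have "nf (pbw_comb c) ?p = Poly_Mapping.lookup c m * nf (pbw m) ?p"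
      unfolding nf_comb by (subst sum.remove[OF finite_keys m]) (simp only: add_0_right)
    moreover have "nf (pbw_comb c) ?p = 0"
    proof -
      have "nf (pbw_comb c) = nf f" using T_cong[OF c] by (simp add: nf_def)
      then show ?thesis using \<open>nf f = 0\<close> by simp
    qed
    moreover have "Poly_Mapping.lookup c m \<noteq> 0" using m by (simp add: in_keys_iff)
    ultimately show False
      using nf_pbw(2)[of i j k] unfolding ijk by (metis mult_eq_0_iff)
  qed
  then show "f \<asymp> 0" using c by (simp add: pbw_comb_def)
next
  assume "f \<asymp> 0"
  then show "nf f = 0" using T_cong[of f 0] by (simp add: nf_def T.act_zero_left)
qed

lemma nf_eq_iff: "nf f = nf g \<longleftrightarrow> f \<asymp> g"
  using nf_eq_zero_iff[of "f - g"] unfolding nf_diff serre_cong_def by simp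

definition supp :: "node free_alg \<Rightarrow> (int \<times> int \<times> int) set" where
  "supp f = {m. nf f m \<noteq> 0}"

lemma supp_empty_iff: "supp f = {} \<longleftrightarrow> f \<asymp> 0"
  by (simp add: supp_def fun_eq_iff flip: nf_eq_zero_iff)

text \<open>
  The bound on $k$ holds because each $y$ lowers the power of $x$ by one and raises the degree by one.
\<close>

lemma finite_supp: "finite (supp f)"
  and supp_cone: "(d, a, k) \<in> supp f \<Longrightarrow> 0 \<le> a \<and> a \<le> d \<and> 0 \<le> d + k"
proof -
  let ?N = "{v::int \<times> int \<times> int \<Rightarrow> complex. finite {m. v m \<noteq> 0} \<and>
      (\<forall>d a k. v (d, a, k) \<noteq> 0 \<longrightarrow> 0 \<le> a \<and> a \<le> d \<and> 0 \<le> d + k)}"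
  have "nf f \<in> ?N" unfolding nf_def
  proof (rule T.act_invariant)
    show "delta (0, 0, 0) \<in> ?N" by (auto simp: delta_def)
    show "fscale a w \<in> ?N" if "w \<in> ?N" for a w
      using that finite_subset[of "{m. a * w m \<noteq> 0}" "{m. w m \<noteq> 0}"] by (auto simp: fscale_def)
    show "u + w \<in> ?N" if "u \<in> ?N" "w \<in> ?N" for u w
    proof -
      have "finite ({m. u m \<noteq> 0} \<union> {m. w m \<noteq> 0})" using that by simp
      then have "finite {m. u m + w m \<noteq> 0}" by (rule rev_finite_subset) auto
      moreover have "0 \<le> a \<and> a \<le> d \<and> 0 \<le> d + k" if "(u + w) (d, a, k) \<noteq> 0" for d a k
      proof -
        have "u (d, a, k) \<noteq> 0 \<or> w (d, a, k) \<noteq> 0" using that by auto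
        then show ?thesis using \<open>u \<in> ?N\<close> \<open>w \<in> ?N\<close> by blast
      qed
      ultimately show ?thesis by simp
    qed
    show "torus_op q i w \<in> ?N" if w: "w \<in> ?N" for i w
    proof (cases i)
      case N1
      have "{m. torus_op q N1 w m \<noteq> 0} \<subseteq> (\<lambda>(d, a, k). (d, a, k + 1)) ` {m. w m \<noteq> 0}"
      proof
        fix m assume "m \<in> {m. torus_op q N1 w m \<noteq> 0}"
        moreover obtain d a k where m: "m = (d, a, k)" by (cases m)
        ultimately have "w (d, a, k - 1) \<noteq> 0" by simp
        then show "m \<in> (\<lambda>(d, a, k). (d, a, k + 1)) ` {m. w m \<noteq> 0}"
          unfolding m by (intro image_eqI[of _ _ "(d, a, k - 1)"]) auto
      qed
      then have "finite {m. torus_op q N1 w m \<noteq> 0}"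
        by (rule finite_subset) (use w in simp)
      moreover have "0 \<le> a \<and> a \<le> d \<and> 0 \<le> d + k" if "torus_op q N1 w (d, a, k) \<noteq> 0" for d a k
      proof -
        have "w (d, a, k - 1) \<noteq> 0" using that by simp
        then have "0 \<le> a \<and> a \<le> d \<and> 0 \<le> d + (k - 1)" using w by blast
        then show ?thesis by simp
      qed
      ultimately show ?thesis unfolding N1 by blast
    next
      case N2
      have *: "w (d - 1, a, k + 1) \<noteq> 0 \<or> w (d - 1, a - 1, k + 1) \<noteq> 0" if "torus_op q N2 w (d, a, k) \<noteq> 0" for d a k
        using that by auto
      have "{m. torus_op q N2 w m \<noteq> 0} \<subseteq>
          (\<lambda>(d, a, k). (d + 1, a, k - 1)) ` {m. w m \<noteq> 0} \<union> (\<lambda>(d, a, k). (d + 1, a + 1, k - 1)) ` {m. w m \<noteq> 0}" (is "_ \<subseteq> ?R")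
      proof
        fix m assume "m \<in> {m. torus_op q N2 w m \<noteq> 0}"
        moreover obtain d a k where "m = (d, a, k)" by (cases m)
        ultimately have "w (d - 1, a, k + 1) \<noteq> 0 \<or> w (d - 1, a - 1, k + 1) \<noteq> 0" using * by blast
        then show "m \<in> ?R" using \<open>m = (d, a, k)\<close>
          by (force intro: image_eqI[of _ _ "(d - 1, a, k + 1)"] image_eqI[of _ _ "(d - 1, a - 1, k + 1)"])
      qed
      then have "finite {m. torus_op q N2 w m \<noteq> 0}"
        by (rule finite_subset) (use w in simp)
      moreover have "0 \<le> a \<and> a \<le> d \<and> 0 \<le> d + k" if "torus_op q N2 w (d, a, k) \<noteq> 0" for d a k
      proof -
        have "(0 \<le> a \<and> a \<le> d - 1 \<and> 0 \<le> d - 1 + (k + 1)) \<or> (0 \<le> a - 1 \<and> a - 1 \<le> d - 1 \<and> 0 \<le> d - 1 + (k + 1))"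
          using *[OF that] w by blast
        then show ?thesis by auto
      qed
      ultimately show ?thesis unfolding N2 by blast
    qed
  qed
  then show "finite (supp f)" "(d, a, k) \<in> supp f \<Longrightarrow> 0 \<le> a \<and> a \<le> d \<and> 0 \<le> d + k"
    by (auto simp: supp_def)
qed

lemma fock_vacuum: "k < 0 \<Longrightarrow> W.act f (delta 0) k = 0"
proof -
  let ?N = "{u :: int \<Rightarrow> complex. \<forall>k<0. u k = 0}"
  have "W.act f (delta 0) \<in> ?N"
  proof (rule W.act_invariant)
    show "fock_op q i w \<in> ?N" if "w \<in> ?N" for i w
    proof (cases i)
      case N2
      have "(q powi (k + 1) - q powi (- k - 1)) * w (k + 1) = 0" if "k < 0" for k
        using that \<open>w \<in> ?N\<close> by (cases "k = -1") auto
      then show ?thesis using N2 by simp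
    qed (use that in simp)
  qed (auto simp: delta_def fscale_def)
  then show "k < 0 \<Longrightarrow> W.act f (delta 0) k = 0" by simp
qed

end

section \<open>Multiplication in the quantum torus\<close>

lemma lex_add_less_le:
  fixes a b c d :: "int \<times> int \<times> int"
  shows "a < b \<Longrightarrow> c \<le> d \<Longrightarrow> a + c < b + d"
  by (cases a; cases b; cases c; cases d) auto

context generic_q begin

text \<open>
  Right multiplication by a monomial in the quantum torus; the power of $q$ comes from moving powers of $x$
  past $z$ and $z'$.
\<close>

fun right_mult :: "int \<times> int \<times> int \<Rightarrow> (int \<times> int \<times> int \<Rightarrow> complex)
    \<Rightarrow> int \<times> int \<times> int \<Rightarrow> complex" where
  "right_mult (d', a', k') v =
     (\<lambda>(d, a, k). q powi ((k - k') * (2 * a' - d')) * v (d - d', a - a', k - k'))"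

lemma right_mult_eq_0_iff: "right_mult m v p = 0 \<longleftrightarrow> v (p - m) = 0"
  by (cases m; cases p) (simp add: q_nonzero)

lemma right_mult_delta: "right_mult m (delta (0, 0, 0)) = delta m"
  by (cases m) (auto simp: fun_eq_iff delta_def)

lemma powi_eqI: "a + b = c + d \<Longrightarrow> q powi a * q powi b = q powi c * q powi d"
  using q_nonzero by (simp flip: power_int_add)

lemma right_mult_act: "right_mult m (T.act f v) = T.act f (right_mult m v)"
proof (rule T.act_intertwine)
  obtain d a k where m: "m = (d, a, k)" by (cases m)
  show "right_mult m (v + w) = right_mult m v + right_mult m w"
    and "right_mult m (fscale c v) = fscale c (right_mult m v)" for v w c
    by (simp_all add: m fun_eq_iff fscale_def algebra_simps)
  show "right_mult m (torus_op q i v) = torus_op q i (right_mult m v)" for i v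
  proof (cases i)
    case N1
    have "right_mult m (torus_op q N1 v) (d', a', k') = torus_op q N1 (right_mult m v) (d', a', k')" for d' a' k'
      unfolding m by (simp add: cancel_ab_semigroup_add_class.diff_right_commute[of k' 1 k]) (rule disjI2, rule powi_eqI, simp add: algebra_simps)
    then show ?thesis using N1 by (simp add: fun_eq_iff)
  next
    case N2
    have "right_mult m (torus_op q N2 v) (d', a', k') = torus_op q N2 (right_mult m v) (d', a', k')" for d' a' k'
      unfolding m by (simp add: cancel_ab_semigroup_add_class.diff_right_commute[of _ 1] diff_add_eq right_diff_distrib)
        (intro arg_cong2[where f = "(-)"]; simp; intro disjI2 powi_eqI; simp add: algebra_simps)
    then show ?thesis using N2 by (simp add: fun_eq_iff)
  qed
qed

lemma nf_expand: "nf g = (\<Sum>m\<in>supp g. fscale (nf g m) (delta m))"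
proof
  fix p
  have "(\<Sum>m\<in>supp g. nf g m * delta m p) = (\<Sum>m\<in>supp g. if p = m then nf g m else 0)"
    by (rule sum.cong) (auto simp: delta_def)
  also have "\<dots> = nf g p" by (simp add: finite_supp) (simp add: supp_def)
  finally show "nf g p = (\<Sum>m\<in>supp g. fscale (nf g m) (delta m)) p"
    by (simp add: fun_sum_apply fscale_def)
qed

text \<open>
  The twisted convolution that describes the product in the quantum torus. It follows from the module
  structure alone, since right multiplications commute with the left action.
\<close>

lemma nf_mult_expand: "nf (f * g) p = (\<Sum>m\<in>supp g. nf g m * right_mult m (nf f) p)"
proof -
  have "nf (f * g) = T.act f (\<Sum>m\<in>supp g. fscale (nf g m) (delta m))"
    unfolding nf_mult by (subst nf_expand) simp
  also have "\<dots> = (\<Sum>m\<in>supp g. fscale (nf g m) (right_mult m (nf f)))"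
    by (simp add: T.act_sum_right T.act_sc_right nf_def right_mult_act right_mult_delta)
  finally show ?thesis by (simp add: fun_sum_apply fscale_def)
qed

lemma nf_mult_monomial:
  assumes "nf g = fscale c (delta m)"
  shows "nf (f * g) p = c * right_mult m (nf f) p"
  by (simp only: nf_mult assms T.act_sc_right) (simp add: nf_def right_mult_act right_mult_delta fscale_def)

lemma supp_mult_subset: "p \<in> supp (f * g) \<Longrightarrow> \<exists>a\<in>supp f. \<exists>b\<in>supp g. p = a + b"
proof -
  assume "p \<in> supp (f * g)"
  then have "(\<Sum>m\<in>supp g. nf g m * right_mult m (nf f) p) \<noteq> 0" by (simp add: supp_def nf_mult_expand)
  then obtain m where "m \<in> supp g" "nf g m * right_mult m (nf f) p \<noteq> 0" by (rule sum.not_neutral_contains_not_neutral)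
  then have "m \<in> supp g" "p - m \<in> supp f" by (auto simp: supp_def right_mult_eq_0_iff)
  then show ?thesis by (metis diff_add_cancel)
qed

text \<open>
  No cancellation can occur at an exponent that is a sum of exponents of the factors in only one way.
\<close>

lemma unique_decomp_mem_supp_mult:
  assumes "a \<in> supp f" "b \<in> supp g"
    and "\<And>a' b'. a' \<in> supp f \<Longrightarrow> b' \<in> supp g \<Longrightarrow> a' + b' = a + b \<Longrightarrow> b' = b"
  shows "a + b \<in> supp (f * g)"
proof -
  have "(\<Sum>m\<in>supp g - {b}. nf g m * right_mult m (nf f) (a + b)) = 0"
  proof (rule sum.neutral, rule ballI)
    fix m assume "m \<in> supp g - {b}"
    then show "nf g m * right_mult m (nf f) (a + b) = 0"
    using assms(3)[of "a + b - m" m] by (auto simp: right_mult_eq_0_iff supp_def)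
  qed
  then have "nf (f * g) (a + b) = nf g b * right_mult b (nf f) (a + b)"
    unfolding nf_mult_expand by (subst sum.remove[OF finite_supp assms(2)]) simp
  then show ?thesis using assms(1,2) by (simp add: supp_def right_mult_eq_0_iff)
qed

lemma Max_supp_mult:
  assumes "supp f \<noteq> {}" "supp g \<noteq> {}"
  shows "Max (supp f) + Max (supp g) \<in> supp (f * g)"
proof (rule unique_decomp_mem_supp_mult)
  fix a b assume ab: "a \<in> supp f" "b \<in> supp g" "a + b = Max (supp f) + Max (supp g)"
  show "b = Max (supp g)"
  proof (rule ccontr)
    assume "b \<noteq> Max (supp g)"
    then have "b < Max (supp g)" using ab(2) finite_supp Max_ge by (metis order_le_less)
    moreover have "a \<le> Max (supp f)" using ab(1) finite_supp Max_ge by blast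
    ultimately have "b + a < Max (supp g) + Max (supp f)" by (rule lex_add_less_le)
    then show False using ab(3) by (simp add: add.commute)
  qed
qed (use assms finite_supp Max_in in auto)

lemma Min_supp_mult:
  assumes "supp f \<noteq> {}" "supp g \<noteq> {}"
  shows "Min (supp f) + Min (supp g) \<in> supp (f * g)"
proof (rule unique_decomp_mem_supp_mult)
  fix a b assume ab: "a \<in> supp f" "b \<in> supp g" "a + b = Min (supp f) + Min (supp g)"
  show "b = Min (supp g)"
  proof (rule ccontr)
    assume "b \<noteq> Min (supp g)"
    then have "Min (supp g) < b" using ab(2) finite_supp Min_le by (metis order_le_less)
    moreover have "Min (supp f) \<le> a" using ab(1) finite_supp Min_le by blast
    ultimately have "Min (supp g) + Min (supp f) < b + a" by (rule lex_add_less_le)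
    then show False using ab(3) by (simp add: add.commute)
  qed
qed (use assms finite_supp Min_in in auto)

lemma supp_factors_nonempty:
  assumes "supp (f * g) \<noteq> {}"
  shows "supp f \<noteq> {}" "supp g \<noteq> {}"
  using assms supp_mult_subset by fast+

text \<open>
  The extremal exponents of a product are the sums of the extremal exponents of the factors. If the
  product has constant degree, the greatest and least degrees of the factors have equal sums, hence agree.
\<close>

lemma supp_mult_homogeneous:
  assumes "supp (f * g) \<noteq> {}" and hom: "\<And>m. m \<in> supp (f * g) \<Longrightarrow> fst m = e"
  obtains e1 e2 where "e1 + e2 = e" "\<forall>m\<in>supp f. fst m = e1" "\<forall>m\<in>supp g. fst m = e2"
proof -
  note ne = supp_factors_nonempty[OF assms(1)]
  have max: "fst (Max (supp f)) + fst (Max (supp g)) = e"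
    using hom[OF Max_supp_mult[OF ne]] by simp
  have min: "fst (Min (supp f)) + fst (Min (supp g)) = e"
    using hom[OF Min_supp_mult[OF ne]] by simp
  have fst_mono: "fst a \<le> fst b" if "a \<le> b" for a b :: "int \<times> int \<times> int"
    using that by (cases a; cases b) auto
  have le: "fst (Min (supp h)) \<le> fst m \<and> fst m \<le> fst (Max (supp h))" if "m \<in> supp h" for h m
    using that finite_supp by (auto intro!: fst_mono)
  obtain a b where "a \<in> supp f" "b \<in> supp g" using ne by blast
  from le[OF this(1)] le[OF this(2)]
  have "fst (Min (supp f)) \<le> fst (Max (supp f))" "fst (Min (supp g)) \<le> fst (Max (supp g))"
    by linarith+
  then have eq: "fst (Min (supp f)) = fst (Max (supp f))" "fst (Min (supp g)) = fst (Max (supp g))"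
    using max min by linarith+
  show thesis
  proof (rule that[OF max])
    show "\<forall>m\<in>supp f. fst m = fst (Max (supp f))" using le[of _ f] eq by force
    show "\<forall>m\<in>supp g. fst m = fst (Max (supp g))" using le[of _ g] eq by force
  qed
qed

text \<open>
  The same argument as for degrees, now for the exponents themselves: factors of monomials are monomials.
\<close>

lemma supp_mult_singleton:
  assumes "supp (f * g) = {p}"
  obtains a b where "supp f = {a}" "supp g = {b}" "a + b = p"
proof -
  have ne: "supp f \<noteq> {}" "supp g \<noteq> {}" using supp_factors_nonempty[of f g] assms by auto
  have max: "Max (supp f) + Max (supp g) = p" using Max_supp_mult[OF ne] assms by simp
  have min: "Min (supp f) + Min (supp g) = p" using Min_supp_mult[OF ne] assms by simp
  have le: "Min (supp f) \<le> Max (supp f)" "Min (supp g) \<le> Max (supp g)"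
    using ne finite_supp by (auto intro: order_trans[OF Min_le Max_ge])
  have eqf: "Min (supp f) = Max (supp f)"
  proof (rule ccontr)
    assume "Min (supp f) \<noteq> Max (supp f)"
    then have "Min (supp f) < Max (supp f)" using le by simp
    then have "Min (supp f) + Min (supp g) < Max (supp f) + Max (supp g)"
      using le(2) by (rule lex_add_less_le)
    then show False using max min by simp
  qed
  then have "Min (supp g) = Max (supp g)" using max min by (metis add_left_cancel)
  have single: "supp h = {Max (supp h)}" if "supp h \<noteq> {}" "Min (supp h) = Max (supp h)" for h
  proof -
    have "m = Max (supp h)" if "m \<in> supp h" for m
      using Min_le[OF finite_supp that] Max_ge[OF finite_supp that] \<open>Min (supp h) = Max (supp h)\<close> by simp
    then show ?thesis using \<open>supp h \<noteq> {}\<close> by blast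
  qed
  show thesis by (rule that[OF single[OF ne(1) eqf] single[OF ne(2) \<open>Min (supp g) = Max (supp g)\<close>] max])
qed

text \<open>
  The exponents of elements of the algebra lie in a pointed cone, so $0$ is a sum of two of them only
  as $0 + 0$.
\<close>

lemma augmentation_mult: "nf (f * g) (0, 0, 0) = nf f (0, 0, 0) * nf g (0, 0, 0)"
proof -
  have *: "nf g m * right_mult m (nf f) (0, 0, 0) = 0" if "m \<in> supp g" "m \<noteq> (0, 0, 0)" for m
  proof (rule ccontr)
    obtain d a k where m: "m = (d, a, k)" by (cases m)
    assume "nf g m * right_mult m (nf f) (0, 0, 0) \<noteq> 0"
    then have "(-d, -a, -k) \<in> supp f" by (auto simp: right_mult_eq_0_iff m supp_def)
    from supp_cone[OF this] supp_cone[of d a k g] that show False unfolding m by auto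
  qed
  show ?thesis
  proof (cases "(0, 0, 0) \<in> supp g")
    case True
    then show ?thesis unfolding nf_mult_expand
      by (subst sum.remove[OF finite_supp True]) (simp add: *)
  next
    case False
    then have "nf (f * g) (0, 0, 0) = 0" unfolding nf_mult_expand by (intro sum.neutral) (metis *)
    then show ?thesis using False by (simp add: supp_def)
  qed
qed

lemma nf_x: "nf x = delta (0, 0, 1)"
  and nf_y: "nf y = (\<lambda>p. delta (1, 0, -1) p - delta (1, 1, -1) p)"
  and nf_z: "nf z = fscale s (delta (1, 1, 0))"
  and nf_z': "nf z' = fscale s (delta (1, 0, 0))"
  by (auto simp: nf_def fun_eq_iff T_x T_y T_z T_z' delta_def fscale_def simp del: torus_op.simps)

section \<open>The centre, and the monomials of the algebra\<close>

lemma q_neq_1: "q \<noteq> 1"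
  using q_not_root_of_unity[rule_format, of 1] by simp

lemma congI: "(\<And>p. nf f p = nf g p) \<Longrightarrow> f \<asymp> g"
  by (simp add: fun_eq_iff flip: nf_eq_iff)

lemma nf_mult_x: "nf (f * x) (d, a, k) = nf f (d, a, k - 1)"
  using nf_mult_monomial[of x 1 "(0, 0, 1)" f "(d, a, k)"] by (simp add: nf_x fscale_def)

lemma nf_mult_z: "nf (f * z) (d, a, k) = s * q powi k * nf f (d - 1, a - 1, k)"
  using nf_mult_monomial[of z s "(1, 1, 0)" f "(d, a, k)"] by (simp add: nf_z)

lemma nf_mult_z': "nf (f * z') (d, a, k) = s * q powi (- k) * nf f (d - 1, a, k)"
  using nf_mult_monomial[of z' s "(1, 0, 0)" f "(d, a, k)"] by (simp add: nf_z')

abbreviation central_elt :: "node free_alg" where "central_elt \<equiv> z * z'"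

lemma central_elt_commutes: "central_elt * f \<asymp> f * central_elt"
proof (rule congI)
  fix p :: "int \<times> int \<times> int"
  obtain d a k where p: "p = (d, a, k)" by (cases p)
  have "nf (f * z * z') (d, a, k) = nf (z * z' * f) (d, a, k)"
    by (simp add: nf_mult_z' nf_mult_z power_int_minus q_nonzero) (simp add: nf_mult T.act_mult T_z T_z' q_nonzero)
  then show "nf (central_elt * f) p = nf (f * central_elt) p" by (simp add: p mult.assoc)
qed

text \<open>
  Conjugation by $x$ multiplies a monomial by a power of $q$ which is trivial only for $d = 2a$, and
  conjugation by $z$ by one which is trivial only for $k = 0$. Hence the centre consists of the
  polynomials in $zz'$.
\<close>

lemma central_supp:
  assumes "\<And>g. f * g \<asymp> g * f" and "(d, a, k) \<in> supp f"
  shows "d = 2 * a" "k = 0"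
proof -
  have "nf (f * x) (d, a, k + 1) = nf (x * f) (d, a, k + 1)"
    using assms(1)[of x] by (simp flip: nf_eq_iff)
  then have "nf f (d, a, k) = q powi (2 * a - d) * nf f (d, a, k)"
    by (simp add: nf_mult_x) (simp add: nf_mult T_x)
  then show "d = 2 * a" using assms(2) powi_q_eq_1_iff[of "2 * a - d"] by (simp add: supp_def)
  have "nf (f * z) (d + 1, a + 1, k) = nf (z * f) (d + 1, a + 1, k)"
    using assms(1)[of z] by (simp flip: nf_eq_iff)
  then have "s * q powi k * nf f (d, a, k) = s * nf f (d, a, k)"
    by (simp add: nf_mult_z) (simp add: nf_mult T_z)
  then show "k = 0" using assms(2) powi_q_eq_1_iff[of k] s_nonzero by (simp add: supp_def)
qed

lemma nf_central_power: "nf (central_elt ^ n) = fscale (s ^ (2 * n)) (delta (2 * int n, int n, 0))"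
proof (induction n)
  case 0
  show ?case by (simp add: fun_eq_iff nf_def T.act_one fscale_def)
next
  case (Suc n)
  show ?case
  proof
    fix p :: "int \<times> int \<times> int"
    obtain d a k where p: "p = (d, a, k)" by (cases p)
    have "nf (central_elt ^ Suc n) p = s * (s * nf (central_elt ^ n) (d - 2, a - 1, k))"
      by (simp add: nf_mult T.act_mult T_z T_z' p)
    also have "\<dots> = fscale (s ^ (2 * Suc n)) (delta (2 * int (Suc n), int (Suc n), 0)) p"
      by (auto simp: Suc fscale_def delta_def p)
    finally show "nf (central_elt ^ Suc n) p = fscale (s ^ (2 * Suc n)) (delta (2 * int (Suc n), int (Suc n), 0)) p" .
  qed
qed

lemma central_dvd:
  assumes central: "\<And>g. f * g \<asymp> g * f" and aug: "nf f (0, 0, 0) = 0"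
  obtains h where "f \<asymp> central_elt * h"
proof -
  have m: "\<exists>n. m = (2 * int (Suc n), int (Suc n), 0)" if "m \<in> supp f" for m
  proof -
    obtain d a k where dak: "m = (d, a, k)" by (cases m)
    have 1: "d = 2 * a" "k = 0" using central_supp[OF central] that unfolding dak by blast+
    have "0 \<le> a" using supp_cone[of d a k f] that unfolding dak by blast
    moreover have "a \<noteq> 0" using that aug 1 unfolding dak by (auto simp: supp_def)
    ultimately have "a = int (Suc (nat a - 1))" by linarith
    then show ?thesis using 1 dak by metis
  qed
  define e :: "int \<times> int \<times> int \<Rightarrow> nat" where "e m = nat (fst (snd m))" for m
  define h where "h = (\<Sum>m\<in>supp f. scalar (nf f m * inverse (s ^ (2 * e m))) * central_elt ^ (e m - 1))"
  have "central_elt * h = (\<Sum>m\<in>supp f. scalar (nf f m * inverse (s ^ (2 * e m))) * central_elt ^ e m)"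
    unfolding h_def sum_distrib_left
  proof (rule sum.cong)
    fix m assume "m \<in> supp f"
    then have "e m = Suc (e m - 1)" using m[of m] by (auto simp: e_def)
    then show "central_elt * (scalar (nf f m * inverse (s ^ (2 * e m))) * central_elt ^ (e m - 1))
        = scalar (nf f m * inverse (s ^ (2 * e m))) * central_elt ^ e m"
      by (metis scalar_left_commute power_Suc)
  qed simp
  then have "nf (central_elt * h) = (\<Sum>m\<in>supp f. fscale (nf f m * inverse (s ^ (2 * e m))) (nf (central_elt ^ e m)))"
    by (simp only: nf_def T.act_sum_left T.act_scalar_mult)
  also have "\<dots> = (\<Sum>m\<in>supp f. fscale (nf f m) (delta m))"
  proof (rule sum.cong)
    fix m assume "m \<in> supp f"
    then obtain n where "m = (2 * int (Suc n), int (Suc n), 0)" using m by blast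
    then have "m = (2 * int (e m), int (e m), 0)" by (simp add: e_def)
    then have "nf (central_elt ^ e m) = fscale (s ^ (2 * e m)) (delta m)" using nf_central_power[of "e m"] by simp
    then show "fscale (nf f m * inverse (s ^ (2 * e m))) (nf (central_elt ^ e m)) = fscale (nf f m) (delta m)"
      using s_nonzero by (simp only:) (simp add: fscale_def fun_eq_iff)
  qed simp
  also have "\<dots> = nf f" by (rule nf_expand[symmetric])
  finally have "f \<asymp> central_elt * h" by (simp flip: nf_eq_iff)
  then show thesis by (rule that)
qed

lemma supp_singletonD:
  assumes "supp f = {m}"
  shows "nf f m \<noteq> 0" "nf f = fscale (nf f m) (delta m)"
proof -
  have "nf f p \<noteq> 0 \<longleftrightarrow> p = m" for p using assms by (auto simp: supp_def)
  then show "nf f m \<noteq> 0" "nf f = fscale (nf f m) (delta m)"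
    by (auto simp: fun_eq_iff fscale_def delta_def)
qed

text \<open>
  If $z^a z'^b x^k$ with $k < 0$ were in the algebra, say as the image of $f$, then $f x^{-k}$ would be a
  nonzero multiple of $z^a z'^b$. In the oscillator representation, the latter acts on $e_k$ by a nonzero
  scalar, while $f x^{-k} e_k = f e_0$ has no component at $e_k$.
\<close>

lemma monomial_nonneg:
  assumes "supp f = {(d, a, k)}"
  shows "0 \<le> k"
proof (rule ccontr)
  assume "\<not> 0 \<le> k"
  define n where "n = nat (- k)"
  have n: "int n = - k" "n > 0" using \<open>\<not> 0 \<le> k\<close> by (auto simp: n_def)
  have "(d, a, k) \<in> supp f" using assms by simp
  then have da: "0 \<le> a" "a \<le> d" using supp_cone by blast+
  define c where "c = nf f (d, a, k)"
  have c: "c \<noteq> 0" "nf f = fscale c (delta (d, a, k))"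
    using supp_singletonD[OF assms] by (simp_all add: c_def)
  define i where "i = nat a"
  define j where "j = nat (d - a)"
  have ij: "int i = a" "int j = d - a" using da by (auto simp: i_def j_def)
  have zp: "T.act (z' ^ j) v (d, a, k) = s ^ j * v (d - int j, a, k)" for v d a k j
    by (induction j arbitrary: v d a) (simp_all add: T.act_one T.act_mult T_z' algebra_simps)
  let ?m = "z ^ i * z' ^ j"
  have nf_m: "nf ?m = fscale (s ^ (i + j)) (delta (d, a, 0))"
  proof
    fix p :: "int \<times> int \<times> int"
    obtain d' a' k' where p: "p = (d', a', k')" by (cases p)
    show "nf ?m p = fscale (s ^ (i + j)) (delta (d, a, 0)) p"
      unfolding p using ij by (auto simp: nf_def T.act_mult T_z_power zp fscale_def delta_def power_add)
  qed
  have "nf (f * x ^ n) p = nf (scalar (c * inverse (s ^ (i + j))) * ?m) p" for p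
  proof -
    have "nf (x ^ n) = fscale 1 (delta (0, 0, int n))" by (simp add: nf_x_power fscale_def)
    from nf_mult_monomial[OF this, of f p] have "nf (f * x ^ n) p = c * delta (d, a, 0) p"
      using n by (cases p) (auto simp: c fscale_def delta_def)
    also have "\<dots> = nf (scalar (c * inverse (s ^ (i + j))) * ?m) p"
      using s_nonzero by (simp add: nf_scalar_mult nf_m fscale_def)
    finally show ?thesis .
  qed
  then have "f * x ^ n \<asymp> scalar (c * inverse (s ^ (i + j))) * ?m" by (rule congI)
  then have eq: "W.act (f * x ^ n) (delta k) k = W.act (scalar (c * inverse (s ^ (i + j))) * ?m) (delta k) k"
    by (simp only: W_cong)
  have xk: "W.act (x ^ n) u l = u (l - int n)" for u l n
    by (induction n arbitrary: u l) (simp_all add: W.act_one W.act_mult W_x algebra_simps del: fock_op.simps)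
  have "W.act (x ^ n) (delta k) = delta 0" using n by (auto simp: fun_eq_iff xk delta_def)
  then have lhs: "W.act (f * x ^ n) (delta k) k = W.act f (delta 0) k"
    by (simp add: W.act_mult)
  have "W.act (z ^ i) u l = (s * q powi (- l - 1)) ^ i * u l" for u l i
    by (induction i) (simp_all add: W.act_one W.act_mult W_z)
  moreover have "W.act (z' ^ j) u l = (s * q powi (l + 1)) ^ j * u l" for u l j
    by (induction j) (simp_all add: W.act_one W.act_mult W_z')
  ultimately have "W.act (scalar (c * inverse (s ^ (i + j))) * ?m) (delta k) k =
      c * inverse (s ^ (i + j)) * ((s * q powi (- k - 1)) ^ i * (s * q powi (k + 1)) ^ j)"
    by (simp only: W.act_scalar_mult) (simp add: W.act_mult fscale_def delta_def)
  then have "W.act f (delta 0) k \<noteq> 0"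
    using eq lhs c(1) s_nonzero q_nonzero by simp
  then show False using fock_vacuum[of k f] \<open>\<not> 0 \<le> k\<close> by simp
qed

text \<open>
  The cone condition leaves only $x$ for the first element and $z'x^{-1}, zx^{-1}$ for the second. The
  second element is proportional to $y = (z' - z)x^{-1}$, because otherwise subtracting a multiple of $y$
  would yield the monomial $zx^{-1}$, whose power of $x$ is negative.
\<close>

lemma homogeneous_weight_vectors_scalar_gens:
  assumes u: "\<And>d a k. (d, a, k) \<in> supp u \<Longrightarrow> d = d1 \<and> k = 1" "supp u \<noteq> {}"
    and w: "\<And>d a k. (d, a, k) \<in> supp w \<Longrightarrow> d = d2 \<and> k = - 1" "supp w \<noteq> {}"
    and "d1 + d2 = 1"
  obtains p r where "p \<noteq> 0" "r \<noteq> 0" "u \<asymp> scalar p * x" "w \<asymp> scalar r * y"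
proof -
  obtain d a k d' a' k' where m: "(d, a, k) \<in> supp u" "(d', a', k') \<in> supp w"
    using u(2) w(2) by (metis all_not_in_conv prod_cases3)
  have "0 \<le> d1" "1 \<le> d2"
    using u(1)[OF m(1)] w(1)[OF m(2)] supp_cone[OF m(1)] supp_cone[OF m(2)] by auto
  then have d: "d1 = 0" "d2 = 1" using \<open>d1 + d2 = 1\<close> by auto
  have su: "m = (0, 0, 1)" if "m \<in> supp u" for m
    using that u(1) supp_cone d by (cases m) fastforce
  have sw: "m = (1, 0, - 1) \<or> m = (1, 1, - 1)" if "m \<in> supp w" for m
  proof -
    obtain d a k where dak: "m = (d, a, k)" by (cases m)
    have "d = 1" "k = - 1" using w(1) that d unfolding dak by blast+
    moreover have "0 \<le> a" "a \<le> d" using supp_cone that unfolding dak by blast+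
    ultimately show ?thesis using dak by auto
  qed
  have "supp u = {(0, 0, 1)}" using su u(2) by blast
  note u' = supp_singletonD[OF this]
  have 1: "u \<asymp> scalar (nf u (0, 0, 1)) * x"
    by (rule congI) (subst u'(2), simp add: nf_scalar_mult nf_x fscale_def)
  define r where "r = nf w (1, 0, - 1)"
  have w': "nf w p = r * delta (1, 0, - 1) p + nf w (1, 1, - 1) * delta (1, 1, - 1) p" for p
    using sw[of p] by (auto simp: supp_def delta_def r_def)
  have diff: "nf (w - scalar r * y) p = (r + nf w (1, 1, - 1)) * delta (1, 1, - 1) p" for p
    by (simp add: nf_diff nf_scalar_mult nf_y w'[of p] algebra_simps)
  have "r + nf w (1, 1, - 1) = 0"
  proof (rule ccontr)
    assume "r + nf w (1, 1, - 1) \<noteq> 0"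
    then have "supp (w - scalar r * y) = {(1, 1, - 1)}"
      by (auto simp: supp_def diff delta_def)
    then show False using monomial_nonneg by fastforce
  qed
  then have 2: "w \<asymp> scalar r * y"
    using diff by (intro congI) (simp add: nf_diff)
  moreover have "r \<noteq> 0"
  proof
    assume "r = 0"
    then have "supp w = {}" using 2 by (simp add: supp_empty_iff)
    then show False using w(2) by simp
  qed
  ultimately show thesis using that u'(1) 1 by blast
qed

section \<open>Images of the generators under an automorphism\<close>

lemma supp_eq_z_imp_scalar_z:
  assumes "supp v = {(1, 1, 0)}"
  obtains c where "c \<noteq> 0" "v \<asymp> scalar c * z"
proof -
  note v = supp_singletonD[OF assms]
  have "v \<asymp> scalar (nf v (1, 1, 0) / s) * z"
    by (rule congI) (subst v(2), use s_nonzero in \<open>simp add: nf_scalar_mult nf_z fscale_def\<close>)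
  then show thesis using that[of "nf v (1, 1, 0) / s"] v(1) s_nonzero by simp
qed

lemma supp_eq_z'_imp_scalar_z':
  assumes "supp v = {(1, 0, 0)}"
  obtains c where "c \<noteq> 0" "v \<asymp> scalar c * z'"
proof -
  note v = supp_singletonD[OF assms]
  have "v \<asymp> scalar (nf v (1, 0, 0) / s) * z'"
    by (rule congI) (subst v(2), use s_nonzero in \<open>simp add: nf_scalar_mult nf_z' fscale_def\<close>)
  then show thesis using that[of "nf v (1, 0, 0) / s"] v(1) s_nonzero by simp
qed

lemma q_commute_supp_z:
  assumes "supp v = {(1, 1, 0)}" "u * v \<asymp> scalar e * (v * u)" "(d, a, k) \<in> supp u"
  shows "q powi k = e"
proof -
  obtain c where c: "c \<noteq> 0" "v \<asymp> scalar c * z" using supp_eq_z_imp_scalar_z[OF assms(1)] .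
  have "scalar c * (u * z) = u * (scalar c * z)" by (rule scalar_left_commute[symmetric])
  also have "\<dots> \<asymp> u * v" by (rule serre_cong_mult_left[OF serre_cong_sym[OF c(2)]])
  also note assms(2)
  also have "scalar e * (v * u) \<asymp> scalar e * (scalar c * z * u)"
    by (intro serre_cong_mult_left serre_cong_mult_right c)
  finally have "nf (scalar c * (u * z)) (d + 1, a + 1, k) = nf (scalar e * (scalar c * z * u)) (d + 1, a + 1, k)"
    by (simp flip: nf_eq_iff)
  then have "c * (s * q powi k * nf u (d, a, k)) = e * (c * (s * nf u (d, a, k)))"
    by (simp add: nf_scalar_mult nf_mult_z mult.assoc) (simp add: nf_mult T_z)
  then show ?thesis using c(1) s_nonzero assms(3) by (simp add: supp_def)
qed

lemma q_commute_supp_z':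
  assumes "supp v = {(1, 0, 0)}" "u * v \<asymp> scalar e * (v * u)" "(d, a, k) \<in> supp u"
  shows "q powi (- k) = e"
proof -
  obtain c where c: "c \<noteq> 0" "v \<asymp> scalar c * z'" using supp_eq_z'_imp_scalar_z'[OF assms(1)] .
  have "scalar c * (u * z') = u * (scalar c * z')" by (rule scalar_left_commute[symmetric])
  also have "\<dots> \<asymp> u * v" by (rule serre_cong_mult_left[OF serre_cong_sym[OF c(2)]])
  also note assms(2)
  also have "scalar e * (v * u) \<asymp> scalar e * (scalar c * z' * u)"
    by (intro serre_cong_mult_left serre_cong_mult_right c)
  finally have "nf (scalar c * (u * z')) (d + 1, a, k) = nf (scalar e * (scalar c * z' * u)) (d + 1, a, k)"
    by (simp flip: nf_eq_iff)
  then have "c * (s * q powi (- k) * nf u (d, a, k)) = e * (c * (s * nf u (d, a, k)))"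
    by (simp add: nf_scalar_mult nf_mult_z' mult.assoc) (simp add: nf_mult T_z')
  then show ?thesis using c(1) s_nonzero assms(3) by (simp add: supp_def)
qed

end

text \<open>
  An automorphism of the quotient algebra, represented by an arbitrary choice of representatives. Such a
  choice respects the operations only modulo the Serre ideal.
\<close>

locale automorphism_lift = generic_q +
  fixes \<tau> :: "node free_alg \<Rightarrow> node free_alg"
  assumes tau_cong_iff: "serre_cong q (\<tau> f) (\<tau> g) \<longleftrightarrow> serre_cong q f g"
    and tau_add: "serre_cong q (\<tau> (f + g)) (\<tau> f + \<tau> g)"
    and tau_mult: "serre_cong q (\<tau> (f * g)) (\<tau> f * \<tau> g)"
    and tau_scalar: "serre_cong q (\<tau> (scalar c)) (scalar c)"
    and tau_surj: "\<exists>f. serre_cong q (\<tau> f) g"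
begin

lemma nf_tau_add: "nf (\<tau> (f + g)) = nf (\<tau> f) + nf (\<tau> g)"
  using tau_add[of f g] by (simp flip: nf_eq_iff nf_add)

lemma nf_tau_mult: "nf (\<tau> (f * g)) = nf (\<tau> f * \<tau> g)"
  using tau_mult[of f g] by (simp flip: nf_eq_iff)

lemma nf_tau_scalar: "nf (\<tau> (scalar c)) = nf (scalar c)"
  using tau_scalar[of c] by (simp flip: nf_eq_iff)

lemma tau_scalar_mult: "\<tau> (scalar c * f) \<asymp> scalar c * \<tau> f"
  using tau_mult[of "scalar c" f] serre_cong_mult_right[OF tau_scalar] serre_cong_trans by blast

lemma nf_tau_scalar_mult: "nf (\<tau> (scalar c * f)) = nf (scalar c * \<tau> f)"
  using tau_scalar_mult by (simp add: nf_eq_iff)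

lemma nf_tau_cong: "f \<asymp> g \<Longrightarrow> nf (\<tau> f) = nf (\<tau> g)"
  by (simp add: nf_eq_iff tau_cong_iff)

lemma nf_tau_diff: "nf (\<tau> (f - g)) = nf (\<tau> f) - nf (\<tau> g)"
  using nf_tau_add[of "f - g" g] by simp

lemma supp_tau_empty_iff: "supp (\<tau> f) = {} \<longleftrightarrow> supp f = {}"
proof -
  have "\<tau> 0 \<asymp> 0" using tau_scalar[of 0] by simp
  then have "\<tau> f \<asymp> 0 \<longleftrightarrow> \<tau> f \<asymp> \<tau> 0" using serre_cong_trans serre_cong_sym by blast
  then show ?thesis by (simp add: supp_empty_iff tau_cong_iff)
qed

text \<open>
  The composite of the automorphism with the augmentation, a character of the algebra.
\<close>

definition aug :: "node free_alg \<Rightarrow> complex" where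
  "aug f = nf (\<tau> f) (0, 0, 0)"

lemma aug_mult: "aug (f * g) = aug f * aug g"
  and aug_diff: "aug (f - g) = aug f - aug g"
  and aug_cong: "f \<asymp> g \<Longrightarrow> aug f = aug g"
  by (simp_all add: aug_def nf_tau_mult augmentation_mult nf_tau_diff nf_tau_cong)

lemma aug_scalar_mult: "aug (scalar c * f) = c * aug f"
  by (simp only: aug_def nf_tau_scalar_mult nf_scalar_mult)

text \<open>
  Holds for every character: $xz = q\,zx$ forces the product of the values at $x$ and $z$ to vanish, and
  the values at $z$ and $z'$ are multiples of the product of the values at $x$ and $y$.
\<close>

lemma aug_z: "aug z = 0" and aug_z': "aug z' = 0"
proof -
  have z: "aug (root_vec t) = (1 - t) * (aug x * aug y)" for t
    by (simp only: root_vec_def aug_diff aug_scalar_mult) (simp add: aug_mult algebra_simps)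
  have "aug x * aug z = q * aug z * aug x"
    using aug_cong[OF x_z] by (simp only: mult.assoc aug_scalar_mult) (simp add: aug_mult)
  then have "aug x * aug z = 0" using q_neq_1 by (simp add: algebra_simps)
  then have "aug x * aug y = 0" using z[of "inverse q"] q_neq_1 q_nonzero by (auto simp: field_simps)
  then show "aug z = 0" "aug z' = 0" by (simp_all add: z)
qed

text \<open>
  The preimage of $zz'$ is central. Its constant term vanishes: modulo this constant it is a multiple
  of $zz'$, whose image under the automorphism has augmentation $0$, as has $zz'$ itself. So the image
  of $zz'$ divides the monomial $zz'$.
\<close>

lemma supp_tau_central: "supp (\<tau> central_elt) = {(2, 1, 0)}"
proof -
  have supp_C: "supp central_elt = {(2, 1, 0)}"
    using s_nonzero nf_central_power[of 1] by (auto simp: supp_def fscale_def delta_def)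
  obtain \<zeta> where \<zeta>: "\<tau> \<zeta> \<asymp> central_elt" using tau_surj by blast
  have comm: "\<tau> f * \<tau> g \<asymp> \<tau> g * \<tau> f \<longleftrightarrow> f * g \<asymp> g * f" for f g
    using tau_mult[of f g] tau_mult[of g f] tau_cong_iff[of "f * g" "g * f"]
    by (meson serre_cong_sym serre_cong_trans)
  have \<zeta>_central: "\<zeta> * g \<asymp> g * \<zeta>" for g
  proof -
    have "\<tau> \<zeta> * \<tau> g \<asymp> central_elt * \<tau> g" by (rule serre_cong_mult_right[OF \<zeta>])
    also have "\<dots> \<asymp> \<tau> g * central_elt" by (rule central_elt_commutes)
    also have "\<dots> \<asymp> \<tau> g * \<tau> \<zeta>" by (rule serre_cong_mult_left[OF serre_cong_sym[OF \<zeta>]])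
    finally show ?thesis by (simp add: comm)
  qed
  \<comment> \<open>the constant term; shown below to be zero\<close>
  define c where "c = nf \<zeta> (0, 0, 0)"
  have "(\<zeta> - scalar c) * g \<asymp> g * (\<zeta> - scalar c)" for g
    using \<zeta>_central[of g] by (simp add: serre_cong_def algebra_simps scalar_commute)
  moreover have "nf (\<zeta> - scalar c) (0, 0, 0) = 0" by (simp add: nf_diff nf_scalar c_def)
  ultimately obtain h where h: "\<zeta> - scalar c \<asymp> central_elt * h" by (rule central_dvd)
  have eq: "nf (\<tau> \<zeta>) - nf (scalar c) = nf (\<tau> central_elt * \<tau> h)"
    using nf_tau_cong[OF h] by (simp only: nf_tau_diff nf_tau_mult nf_tau_scalar)
  have aug_C: "aug central_elt = 0" by (simp add: aug_mult aug_z)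
  have "nf (\<tau> \<zeta>) = nf central_elt" using \<zeta> by (simp add: nf_eq_iff)
  moreover have "c = 0"
  proof -
    have "nf central_elt (0, 0, 0) = 0" by (simp add: augmentation_mult nf_z fscale_def delta_def)
    moreover have "nf (\<tau> central_elt * \<tau> h) (0, 0, 0) = 0"
      using aug_C by (simp add: augmentation_mult aug_def)
    ultimately show ?thesis
      using fun_cong[OF eq, of "(0, 0, 0)"] \<open>nf (\<tau> \<zeta>) = nf central_elt\<close> by (simp add: nf_scalar)
  qed
  ultimately have "nf (\<tau> central_elt * \<tau> h) = nf central_elt" using eq by (simp add: nf_zero)
  then have "supp (\<tau> central_elt * \<tau> h) = {(2, 1, 0)}" using supp_C by (simp add: supp_def)
  then obtain m m' where m: "supp (\<tau> central_elt) = {m}" "supp (\<tau> h) = {m'}" "m + m' = (2, 1, 0)"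
    by (rule supp_mult_singleton)
  obtain d a k d' a' k' where mm: "m = (d, a, k)" "m' = (d', a', k')" by (cases m, cases m')
  have "\<tau> central_elt * g \<asymp> g * \<tau> central_elt" for g
  proof -
    obtain f where f: "\<tau> f \<asymp> g" using tau_surj by blast
    have "\<tau> central_elt * g \<asymp> \<tau> central_elt * \<tau> f" by (rule serre_cong_mult_left[OF serre_cong_sym[OF f]])
    also have "\<dots> \<asymp> \<tau> f * \<tau> central_elt" by (simp add: comm central_elt_commutes)
    also have "\<dots> \<asymp> g * \<tau> central_elt" by (rule serre_cong_mult_right[OF f])
    finally show ?thesis .
  qed
  from central_supp[OF this, of d a k] have "d = 2 * a" "k = 0" using m(1) mm by auto
  moreover have "0 \<le> a" "0 \<le> a'" using supp_cone[of d a k "\<tau> central_elt"] supp_cone[of d' a' k' "\<tau> h"] m mm by auto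
  moreover have "m \<noteq> (0, 0, 0)" using aug_C supp_singletonD(1)[OF m(1)] by (auto simp: aug_def)
  ultimately have "m = (2, 1, 0)" using m(3) mm by auto
  then show ?thesis using m(1) by simp
qed

lemma supp_tau_root_vecs:
  "supp (\<tau> z) = {(1, 1, 0)} \<and> supp (\<tau> z') = {(1, 0, 0)} \<or>
   supp (\<tau> z) = {(1, 0, 0)} \<and> supp (\<tau> z') = {(1, 1, 0)}"
proof -
  have "supp (\<tau> z * \<tau> z') = {(2, 1, 0)}"
    using supp_tau_central by (simp add: supp_def nf_tau_mult)
  then obtain m m' where m: "supp (\<tau> z) = {m}" "supp (\<tau> z') = {m'}" "m + m' = (2, 1, 0)"
    by (rule supp_mult_singleton)
  obtain d a k d' a' k' where mm: "m = (d, a, k)" "m' = (d', a', k')" by (cases m, cases m')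
  have "0 \<le> k" "0 \<le> k'" using monomial_nonneg m mm by blast+
  moreover have "0 \<le> a" "a \<le> d" "0 \<le> a'" "a' \<le> d'"
    using supp_cone[of d a k "\<tau> z"] supp_cone[of d' a' k' "\<tau> z'"] m mm by auto
  moreover have "m \<noteq> (0, 0, 0)" "m' \<noteq> (0, 0, 0)"
    using aug_z aug_z' supp_singletonD(1)[OF m(1)] supp_singletonD(1)[OF m(2)] by (auto simp: aug_def)
  ultimately show ?thesis using m(3) unfolding m(1,2) mm by auto
qed

text \<open>
  Both cases of the preceding lemma are covered by the same computation, with the roles of $x$ and $y$
  exchanged in the second.
\<close>

lemma tau_gens:
  obtains l w where "bij w" "\<forall>i. l i \<noteq> 0" "\<forall>i. \<tau> (gen i) \<asymp> scalar (l (w i)) * gen (w i)"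
proof -
  have rel: "\<tau> f * \<tau> g \<asymp> scalar e * (\<tau> g * \<tau> f)" if "f * g \<asymp> scalar e * (g * f)" for f g e
  proof -
    have "\<tau> f * \<tau> g \<asymp> \<tau> (f * g)" by (rule serre_cong_sym[OF tau_mult])
    also have "\<dots> \<asymp> \<tau> (scalar e * (g * f))" using that by (simp add: tau_cong_iff)
    also have "\<dots> \<asymp> scalar e * \<tau> (g * f)" by (rule tau_scalar_mult)
    also have "\<dots> \<asymp> scalar e * (\<tau> g * \<tau> f)" by (rule serre_cong_mult_left[OF tau_mult])
    finally show ?thesis .
  qed
  have xz: "\<tau> x * \<tau> z \<asymp> scalar q * (\<tau> z * \<tau> x)"
    using x_z by (intro rel) (simp add: mult.assoc)
  have "y * z \<asymp> scalar (inverse q) * (z * y)"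
  proof -
    have "y * z = scalar (inverse q) * (scalar q * y * z)"
      using q_nonzero by (simp flip: mult.assoc scalar_mult)
    also have "\<dots> \<asymp> scalar (inverse q) * (z * y)"
      by (rule serre_cong_mult_left[OF serre_cong_sym[OF z_y]])
    finally show ?thesis .
  qed
  then have yz: "\<tau> y * \<tau> z \<asymp> scalar (inverse q) * (\<tau> z * \<tau> y)" by (rule rel)
  \<comment> \<open>the relation that bounds the degrees of the images of $x$ and $y$\<close>
  have yx: "z' - z = scalar s * (y * x)"
    by (simp add: root_vec_def scalar_add scalar_uminus algebra_simps flip: diff_conv_add_uminus)
      (simp add: scalar_def single_diff algebra_simps)
  have nf_yx: "s * nf (\<tau> y * \<tau> x) p = nf (\<tau> z') p - nf (\<tau> z) p" for p
  proof -
    have "nf (\<tau> z') - nf (\<tau> z) = nf (scalar s * \<tau> (y * x))"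
      by (simp only: nf_tau_diff[symmetric] yx nf_tau_scalar_mult)
    from fun_cong[OF this, of p] show ?thesis by (simp add: nf_scalar_mult nf_tau_mult)
  qed
  have supp_yx: "supp (\<tau> y * \<tau> x) = {(1, 1, 0), (1, 0, 0)}"
  proof -
    have "p \<in> supp (\<tau> y * \<tau> x) \<longleftrightarrow> nf (\<tau> z') p - nf (\<tau> z) p \<noteq> 0" for p
      using s_nonzero by (simp add: supp_def flip: nf_yx)
    moreover have "nf (\<tau> z') p - nf (\<tau> z) p \<noteq> 0 \<longleftrightarrow> p \<in> supp (\<tau> z) \<union> supp (\<tau> z')" for p
    proof -
      have "supp (\<tau> z) \<inter> supp (\<tau> z') = {}" using supp_tau_root_vecs by auto
      then show ?thesis by (auto simp: supp_def)
    qed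
    ultimately show ?thesis using supp_tau_root_vecs by blast
  qed
  then have yx_ne: "supp (\<tau> y * \<tau> x) \<noteq> {}" by (simp only: insert_not_empty not_False_eq_True)
  have yx_deg: "fst m = 1" if m: "m \<in> supp (\<tau> y * \<tau> x)" for m
    using m unfolding supp_yx by (elim insertE) simp_all
  obtain e1 e2 where e: "e1 + e2 = 1"
      "\<forall>m\<in>supp (\<tau> y). fst m = e1" "\<forall>m\<in>supp (\<tau> x). fst m = e2"
    using supp_mult_homogeneous[OF yx_ne yx_deg] .
  have ne: "supp (\<tau> x) \<noteq> {}" "supp (\<tau> y) \<noteq> {}"
    unfolding supp_tau_empty_iff by (auto simp: supp_def nf_x nf_y delta_def fun_eq_iff)
  have powi_inj: "k = l" if "q powi k = q powi l" for k l
  proof -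
    have "q powi (k - l) = 1" using that q_nonzero by (simp add: power_int_diff)
    then show ?thesis by (simp add: powi_q_eq_1_iff)
  qed
  have powi1: "q powi k = q \<longleftrightarrow> k = 1" "q powi k = inverse q \<longleftrightarrow> k = - 1" for k
    using powi_inj[of k 1] powi_inj[of k "- 1"] by (auto simp: power_int_minus)
  from supp_tau_root_vecs show thesis
  proof (elim disjE conjE)
    assume z: "supp (\<tau> z) = {(1, 1, 0)}"
    have xd: "d = e2 \<and> k = 1" if "(d, a, k) \<in> supp (\<tau> x)" for d a k
      using bspec[OF e(3) that] q_commute_supp_z[OF z xz that] by (simp add: powi1)
    have yd: "d = e1 \<and> k = - 1" if "(d, a, k) \<in> supp (\<tau> y)" for d a k
      using bspec[OF e(2) that] q_commute_supp_z[OF z yz that] by (simp add: powi1)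
    obtain p r where pr: "p \<noteq> 0" "r \<noteq> 0" "\<tau> x \<asymp> scalar p * x" "\<tau> y \<asymp> scalar r * y"
      using homogeneous_weight_vectors_scalar_gens[OF xd ne(1) yd ne(2) e(1)[unfolded add.commute[of e1]]] .
    show thesis
    proof (rule that[of id "\<lambda>i. if i = N1 then p else r"])
      show "\<forall>i. \<tau> (gen i) \<asymp> scalar (if id i = N1 then p else r) * gen (id i)"
        by (rule allI, rename_tac i, case_tac i) (use pr in auto)
    qed (use pr in auto)
  next
    assume z: "supp (\<tau> z) = {(1, 0, 0)}"
    have xd: "d = e2 \<and> k = - 1" if "(d, a, k) \<in> supp (\<tau> x)" for d a k
      using bspec[OF e(3) that] q_commute_supp_z'[OF z xz that] by (simp add: powi1)
    have yd: "d = e1 \<and> k = 1" if "(d, a, k) \<in> supp (\<tau> y)" for d a k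
      using bspec[OF e(2) that] q_commute_supp_z'[OF z yz that] by (simp add: powi1)
    obtain p r where pr: "p \<noteq> 0" "r \<noteq> 0" "\<tau> y \<asymp> scalar p * x" "\<tau> x \<asymp> scalar r * y"
      using homogeneous_weight_vectors_scalar_gens[OF yd ne(2) xd ne(1) e(1)] .
    show thesis
    proof (rule that[of "\<lambda>i. if i = N1 then N2 else N1" "\<lambda>i. if i = N1 then p else r"])
      show "bij (\<lambda>i. if i = N1 then N2 else N1)"
      proof (rule involuntory_imp_bij)
        show "(if (if i = N1 then N2 else N1) = N1 then N2 else N1) = i" for i by (cases i) simp_all
      qed
      show "\<forall>i. \<tau> (gen i) \<asymp> scalar (if (if i = N1 then N2 else N1) = N1 then p else r) * gen (if i = N1 then N2 else N1)"
        by (rule allI, rename_tac i, case_tac i) (use pr in auto)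
    qed (use pr in auto)
  qed
qed

end

section \<open>The group isomorphism\<close>

definition serre_coset :: "complex \<Rightarrow> node free_alg \<Rightarrow> node free_alg set" where
  "serre_coset q f = serre_ideal q +>\<^bsub>free_ring\<^esub> f"

lemma serre_coset_eq_iff: "serre_coset q f = serre_coset q g \<longleftrightarrow> serre_cong q f g"
proof -
  interpret R: ring "free_ring :: node free_alg ring" by (rule ring_free_ring)
  have "\<ominus>\<^bsub>free_ring\<^esub> g = - g"
    by (rule R.minus_equality) (simp_all add: free_ring_def)
  then have "f \<ominus>\<^bsub>free_ring\<^esub> g = f - g"
    by (simp add: a_minus_def) (simp add: free_ring_def)
  then show ?thesis
    using R.quotient_eq_iff_same_a_r_cos[OF ideal_serre_ideal, of f g q]
    by (simp add: serre_coset_def serre_cong_def free_ring_def)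
qed

lemma carrier_Uq: "carrier (Uq_plus_sl3 q) = range (serre_coset q)"
  by (auto simp: Uq_plus_sl3_def presented_algebra_def Let_def ring.defs FactRing_def A_RCOSETS_def'
      serre_coset_def serre_ideal_def) (auto simp: free_ring_def)

lemma mult_Uq: "serre_coset q f \<otimes>\<^bsub>Uq_plus_sl3 q\<^esub> serre_coset q g = serre_coset q (f * g)"
proof -
  have "rcoset_mult free_ring (serre_ideal q) (serre_coset q f) (serre_coset q g) = serre_coset q (f \<otimes>\<^bsub>free_ring\<^esub> g)"
    unfolding serre_coset_def by (rule ideal.rcoset_mult_add[OF ideal_serre_ideal]) (simp_all add: free_ring_def)
  then show ?thesis
    by (simp add: Uq_plus_sl3_def presented_algebra_def Let_def ring.defs FactRing_def serre_ideal_def)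
      (simp add: free_ring_def)
qed

lemma add_Uq: "serre_coset q f \<oplus>\<^bsub>Uq_plus_sl3 q\<^esub> serre_coset q g = serre_coset q (f + g)"
proof -
  interpret R: ring "free_ring :: node free_alg ring" by (rule ring_free_ring)
  interpret I: abelian_subgroup "serre_ideal q" free_ring
    by (rule abelian_subgroupI3[OF ideal.axioms(1)[OF ideal_serre_ideal]]) (rule R.abelian_group_axioms)
  have "serre_coset q f <+>\<^bsub>free_ring\<^esub> serre_coset q g = serre_coset q (f \<oplus>\<^bsub>free_ring\<^esub> g)"
    unfolding serre_coset_def by (rule I.a_rcos_sum) (simp_all add: free_ring_def)
  then show ?thesis
    by (simp add: Uq_plus_sl3_def presented_algebra_def Let_def ring.defs FactRing_def serre_ideal_def)
      (simp add: free_ring_def)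
qed

lemma one_Uq: "\<one>\<^bsub>Uq_plus_sl3 q\<^esub> = serre_coset q 1"
  by (simp add: Uq_plus_sl3_def presented_algebra_def Let_def ring.defs FactRing_def serre_ideal_def serre_coset_def)
    (simp add: free_ring_def)

lemma smult_Uq: "c \<odot>\<^bsub>Uq_plus_sl3 q\<^esub> serre_coset q f = serre_coset q (scalar c * f)"
  unfolding serre_coset_def serre_ideal_def Uq_plus_sl3_def by (rule smult_presented_algebra)

text \<open>
  The pair $(\lambda, w)$ stands for the diagram automorphism $w$ followed by the torus automorphism of
  $\lambda$, hence the scalar is indexed by $w(i)$. This order matches the multiplication of the
  semidirect product.
\<close>

definition monomial_hom :: "(node \<Rightarrow> complex) \<Rightarrow> (node \<Rightarrow> node) \<Rightarrow> node free_alg \<Rightarrow> node free_alg" where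
  "monomial_hom l w f = subst.act (\<lambda>i. scalar (l (w i)) * gen (w i)) f 1"

lemma monomial_hom_add: "monomial_hom l w (f + g) = monomial_hom l w f + monomial_hom l w g"
  by (simp add: monomial_hom_def subst.act_add_left)

lemma monomial_hom_mult: "monomial_hom l w (f * g) = monomial_hom l w f * monomial_hom l w g"
proof -
  have "subst.act h f 1 * u = subst.act h f (1 * u)" for h :: "node \<Rightarrow> node free_alg" and u
    by (rule subst.act_intertwine[where R = "\<lambda>v. v * u"]) (simp_all add: distrib_right mult.assoc)
  then show ?thesis by (simp add: monomial_hom_def subst.act_mult)
qed

lemma monomial_hom_scalar: "monomial_hom l w (scalar c) = scalar c"
  by (simp add: monomial_hom_def subst.act_scalar)

lemma monomial_hom_gen: "monomial_hom l w (gen i) = scalar (l (w i)) * gen (w i)"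
  by (simp add: monomial_hom_def subst.act_gen)

lemma monomial_hom_diff: "monomial_hom l w (f - g) = monomial_hom l w f - monomial_hom l w g"
  by (simp add: monomial_hom_def subst.act_diff_left)

lemma monomial_hom_serre:
  "monomial_hom l w (serre q i j) = scalar (l (w i) ^ 2 * l (w j)) * serre q (w i) (w j)"
proof -
  note comm = scalar_left_commute[of "gen k" for k :: node]
  have merge: "scalar c * (scalar d * f) = scalar (c * d) * f" for c d and f :: "node free_alg"
    by (simp add: scalar_mult mult.assoc)
  have comm': "gen k * scalar c = scalar c * gen k" for k :: node and c
    by (simp add: scalar_commute)
  show ?thesis
    by (simp add: serre_def monomial_hom_add monomial_hom_diff monomial_hom_mult monomial_hom_scalar
        monomial_hom_gen power2_eq_square mult.assoc comm comm' merge distrib_left right_diff_distrib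
        mult.commute[where 'a = complex] mult.left_commute[where 'a = complex])
qed

lemma monomial_hom_cong:
  assumes "bij w" "serre_cong q f g"
  shows "serre_cong q (monomial_hom l w f) (monomial_hom l w g)"
proof -
  have serre: "serre q (w N1) (w N2) \<in> serre_ideal q" "serre q (w N2) (w N1) \<in> serre_ideal q"
    using bij_is_inj[OF assms(1), THEN inj_eq, of N1 N2] serre_mem_serre_ideal
    by (cases "w N1"; cases "w N2"; simp)+
  have "ideal {f. monomial_hom l w f \<in> serre_ideal q} free_ring"
    by (rule free_ring_idealI)
      (use monomial_hom_scalar[of l w 0] in \<open>auto simp: monomial_hom_add monomial_hom_mult serre_ideal_zero
        intro: serre_ideal_add serre_ideal_mult_left serre_ideal_mult_right\<close>)
  from serre_ideal_minimal[OF this, of q] serre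
  have "serre_ideal q \<subseteq> {f. monomial_hom l w f \<in> serre_ideal q}"
    by (simp add: monomial_hom_serre serre_ideal_mult_left)
  then show ?thesis using assms(2) by (auto simp: serre_cong_def monomial_hom_diff[symmetric])
qed

lemma monomial_hom_comp:
  assumes "bij w" "bij w'"
  shows "monomial_hom l w (monomial_hom l' w' f) = monomial_hom (\<lambda>i. l i * l' (inv_into UNIV w i)) (w \<circ> w') f"
proof (induction f rule: free_alg_induct)
  case (gen_mult i f)
  have merge: "scalar c * (scalar d * f) = scalar (d * c) * f" for c d and f :: "node free_alg"
    by (simp add: scalar_mult mult.assoc mult.commute[of d])
  show ?case
    using bij_is_inj[OF assms(1)]
    by (simp add: monomial_hom_mult monomial_hom_gen monomial_hom_scalar merge mult.assoc gen_mult)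
qed (simp_all add: monomial_hom_scalar monomial_hom_add)

lemma monomial_hom_id: "monomial_hom (\<lambda>i. 1) (\<lambda>i. i) f = f"
  by (induction f rule: free_alg_induct)
    (simp_all add: monomial_hom_scalar monomial_hom_add monomial_hom_mult monomial_hom_gen)

text \<open>
  Automorphisms are extensional functions on the set of cosets, hence the restriction.
\<close>

definition monomial_auto ::
    "complex \<Rightarrow> (node \<Rightarrow> complex) \<times> (node \<Rightarrow> node) \<Rightarrow> node free_alg set \<Rightarrow> node free_alg set" where
  "monomial_auto q =
    (\<lambda>(l, w). \<lambda>C\<in>range (serre_coset q). serre_coset q (monomial_hom l w (SOME f. serre_coset q f = C)))"

lemma monomial_auto_coset:
  assumes "bij w"
  shows "monomial_auto q (l, w) (serre_coset q f) = serre_coset q (monomial_hom l w f)"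
proof -
  have "serre_coset q (SOME g. serre_coset q g = serre_coset q f) = serre_coset q f" by (rule someI) (rule refl)
  then have "serre_coset q (monomial_hom l w (SOME g. serre_coset q g = serre_coset q f)) = serre_coset q (monomial_hom l w f)"
    unfolding serre_coset_eq_iff by (rule monomial_hom_cong[OF assms])
  then show ?thesis by (simp add: monomial_auto_def)
qed

lemma autdiagr_eq_BijGroup: "autdiagr = BijGroup UNIV"
  using carrier_autdiagr by (simp add: autdiagr_def BijGroup_def)

lemma mult_semidirect:
  assumes "bij w" "bij w'"
  shows "(l, w) \<otimes>\<^bsub>semidirect_product torus autdiagr diagr_act\<^esub> (l', w') =
    (\<lambda>i. l i * l' (inv_into UNIV w i), w \<circ> w')"
proof -
  have "w \<otimes>\<^bsub>autdiagr\<^esub> w' = w \<circ> w'"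
    unfolding autdiagr_eq_BijGroup using assms
    by (simp add: BijGroup_def Bij_def compose_def restrict_def o_def)
  then show ?thesis
    by (simp add: semidirect_product_def torus_def Cstar_def diagr_act_def restrict_def)
qed

lemma carrier_semidirect:
  "carrier (semidirect_product torus autdiagr diagr_act) = {l. \<forall>i. l i \<noteq> 0} \<times> {w. bij w}"
  by (auto simp: semidirect_product_def carrier_torus carrier_autdiagr Bij_def)

lemma monomial_auto_comp:
  assumes "bij w" "bij w'"
  shows "monomial_auto q ((l, w) \<otimes>\<^bsub>semidirect_product torus autdiagr diagr_act\<^esub> (l', w')) (serre_coset q f) =
    monomial_auto q (l, w) (monomial_auto q (l', w') (serre_coset q f))"
  using assms by (simp add: mult_semidirect monomial_auto_coset monomial_hom_comp bij_comp)

lemma monomial_auto_one: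
  "monomial_auto q \<one>\<^bsub>semidirect_product torus autdiagr diagr_act\<^esub> (serre_coset q f) = serre_coset q f"
proof -
  have "\<one>\<^bsub>semidirect_product torus autdiagr diagr_act\<^esub> = (\<lambda>i. 1, \<lambda>i. i)"
    by (simp add: semidirect_product_def torus_def Cstar_def autdiagr_eq_BijGroup BijGroup_def restrict_def)
  moreover have "bij (\<lambda>i :: node. i)" using bij_id by (simp add: id_def)
  ultimately show ?thesis by (simp add: monomial_auto_coset monomial_hom_id)
qed

lemma monomial_auto_mem:
  assumes "g \<in> carrier (semidirect_product torus autdiagr diagr_act)"
  shows "monomial_auto q g \<in> alg_auto (Uq_plus_sl3 q)"
proof -
  let ?S = "semidirect_product torus autdiagr diagr_act"
  interpret S: group ?S by (rule group_semidirect_torus)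
  have closed: "monomial_auto q g C \<in> range (serre_coset q)" if "C \<in> range (serre_coset q)" for g C
    using that by (cases g) (simp add: monomial_auto_def)
  have comp: "monomial_auto q g (monomial_auto q g' C) = C"
    if "g \<in> carrier ?S" "g' \<in> carrier ?S" "g \<otimes>\<^bsub>?S\<^esub> g' = \<one>\<^bsub>?S\<^esub>" "C \<in> range (serre_coset q)" for g g' C
  proof -
    obtain l w l' w' where g: "g = (l, w)" "g' = (l', w')" by (cases g, cases g')
    then have "bij w" "bij w'" using that(1,2) unfolding carrier_semidirect by auto
    then show ?thesis
      using that(3,4) monomial_auto_one g by (auto simp flip: monomial_auto_comp)
  qed
  have "bij_betw (monomial_auto q g) (range (serre_coset q)) (range (serre_coset q))"
  proof (rule bij_betw_byWitness)
    show "\<forall>C\<in>range (serre_coset q). monomial_auto q (inv\<^bsub>?S\<^esub> g) (monomial_auto q g C) = C"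
      using comp[OF S.inv_closed[OF assms] assms S.l_inv[OF assms]] by blast
    show "\<forall>C\<in>range (serre_coset q). monomial_auto q g (monomial_auto q (inv\<^bsub>?S\<^esub> g) C) = C"
      using comp[OF assms S.inv_closed[OF assms] S.r_inv[OF assms]] by blast
  qed (use closed in blast)+
  moreover have "monomial_auto q g \<in> extensional (range (serre_coset q))"
    by (cases g) (simp add: monomial_auto_def)
  moreover obtain l w where g: "g = (l, w)" by (cases g)
  moreover have w: "bij w" using assms unfolding carrier_semidirect g by simp
  moreover have "monomial_auto q g \<in> ring_hom (Uq_plus_sl3 q) (Uq_plus_sl3 q)"
    using closed w monomial_hom_scalar[of l w 1] unfolding g
    by (intro ring_hom_memI) (auto simp: carrier_Uq mult_Uq add_Uq one_Uq monomial_auto_coset monomial_hom_mult monomial_hom_add)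
  ultimately show ?thesis
    by (auto simp: alg_auto_def Bij_def carrier_Uq smult_Uq monomial_auto_coset monomial_hom_mult monomial_hom_scalar)
qed

context generic_q begin

lemma scalar_gen_cong_imp_eq:
  assumes "scalar a * gen i \<asymp> scalar b * gen j" "a \<noteq> 0"
  shows "i = j \<and> a = b"
proof -
  have eq: "a * nf (gen i) p = b * nf (gen j) p" for p
    using assms(1) by (simp add: nf_scalar_mult flip: nf_eq_iff) (metis nf_scalar_mult)
  show ?thesis
    using eq[of "(0, 0, 1)"] eq[of "(1, 0, - 1)"] assms(2)
    by (cases i; cases j) (simp_all add: nf_x nf_y delta_def)
qed

lemma monomial_auto_inj: "inj_on (monomial_auto q) (carrier (semidirect_product torus autdiagr diagr_act))"
proof (rule inj_onI)
  fix g g' assume "g \<in> carrier (semidirect_product torus autdiagr diagr_act)"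
    "g' \<in> carrier (semidirect_product torus autdiagr diagr_act)" "monomial_auto q g = monomial_auto q g'"
  then obtain l w l' w' where g: "g = (l, w)" "g' = (l', w')" "\<And>i. l i \<noteq> 0" "bij w" "bij w'"
    unfolding carrier_semidirect by auto
  have "w i = w' i \<and> l (w i) = l' (w' i)" for i
  proof (rule scalar_gen_cong_imp_eq)
    have "monomial_auto q g (serre_coset q (gen i)) = monomial_auto q g' (serre_coset q (gen i))"
      using \<open>monomial_auto q g = monomial_auto q g'\<close> by simp
    then show "scalar (l (w i)) * gen (w i) \<asymp> scalar (l' (w' i)) * gen (w' i)"
      using g by (simp add: monomial_auto_coset monomial_hom_gen serre_coset_eq_iff)
  qed (rule g(3))
  then have "w = w'" "\<And>i. l (w i) = l' (w i)" by (fastforce, metis)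
  moreover have "l i = l' i" for i
    using \<open>\<And>i. l (w i) = l' (w i)\<close>[of "inv_into UNIV w i"] g(4) by (simp add: bij_is_surj surj_f_inv_f)
  ultimately show "g = g'" using g by auto
qed

lemma monomial_auto_surj:
  assumes "\<sigma> \<in> alg_auto (Uq_plus_sl3 q)"
  shows "\<exists>g \<in> carrier (semidirect_product torus autdiagr diagr_act). monomial_auto q g = \<sigma>"
proof -
  have hom: "\<sigma> \<in> ring_hom (Uq_plus_sl3 q) (Uq_plus_sl3 q)"
    and bij: "bij_betw \<sigma> (range (serre_coset q)) (range (serre_coset q))" and ext: "\<sigma> \<in> extensional (range (serre_coset q))"
    and sm: "\<And>c f. \<sigma> (serre_coset q (scalar c * f)) = c \<odot>\<^bsub>Uq_plus_sl3 q\<^esub> \<sigma> (serre_coset q f)"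
    using assms by (auto simp: alg_auto_def Bij_def carrier_Uq simp flip: smult_Uq)
  define \<tau> where "\<tau> f = (SOME g. serre_coset q g = \<sigma> (serre_coset q f))" for f
  have \<tau>: "serre_coset q (\<tau> f) = \<sigma> (serre_coset q f)" for f
  proof -
    have "\<sigma> (serre_coset q f) \<in> range (serre_coset q)" using bij_betwE[OF bij] by blast
    then obtain g where "serre_coset q g = \<sigma> (serre_coset q f)" by auto
    then show ?thesis unfolding \<tau>_def by (rule someI)
  qed
  interpret automorphism_lift q \<tau>
  proof unfold_locales
    fix f g c
    show "\<tau> f \<asymp> \<tau> g \<longleftrightarrow> f \<asymp> g"
      using inj_on_eq_iff[OF bij_betw_imp_inj_on[OF bij]] by (simp add: \<tau> flip: serre_coset_eq_iff)
    show "\<tau> (f + g) \<asymp> \<tau> f + \<tau> g"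
      unfolding serre_coset_eq_iff[symmetric] \<tau> add_Uq[symmetric]
      using ring_hom_add[OF hom, of "serre_coset q f" "serre_coset q g"] by (simp add: carrier_Uq)
    show "\<tau> (f * g) \<asymp> \<tau> f * \<tau> g"
      unfolding serre_coset_eq_iff[symmetric] \<tau> mult_Uq[symmetric]
      using ring_hom_mult[OF hom, of "serre_coset q f" "serre_coset q g"] by (simp add: carrier_Uq)
    show "\<tau> (scalar c) \<asymp> scalar c"
      unfolding serre_coset_eq_iff[symmetric] \<tau>
      using sm[of c 1] ring_hom_one[OF hom] by (simp add: one_Uq smult_Uq)
    show "\<exists>f. \<tau> f \<asymp> g"
    proof -
      have "serre_coset q g \<in> \<sigma> ` range (serre_coset q)" using bij_betw_imp_surj_on[OF bij] by simp
      then obtain f where "\<sigma> (serre_coset q f) = serre_coset q g" by auto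
      then show ?thesis unfolding serre_coset_eq_iff[symmetric] \<tau> by blast
    qed
  qed
  obtain l w where lw: "bij w" "\<forall>i. l i \<noteq> 0" "\<forall>i. \<tau> (gen i) \<asymp> scalar (l (w i)) * gen (w i)"
    using tau_gens .
  have "\<tau> f \<asymp> monomial_hom l w f" for f
  proof (induction f rule: free_alg_induct)
    case (scalar c)
    show ?case by (simp add: monomial_hom_scalar tau_scalar)
  next
    case (gen_mult i f)
    show ?case
      unfolding monomial_hom_mult monomial_hom_gen
      by (rule serre_cong_trans[OF tau_mult serre_cong_mult[OF lw(3)[rule_format] gen_mult]])
  next
    case (add f g)
    show ?case
      unfolding monomial_hom_add by (rule serre_cong_trans[OF tau_add serre_cong_add[OF add]])
  qed
  then have "monomial_auto q (l, w) (serre_coset q f) = \<sigma> (serre_coset q f)" for f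
    using lw(1) by (simp add: monomial_auto_coset flip: \<tau> serre_coset_eq_iff)
  then have "monomial_auto q (l, w) = \<sigma>"
    by (intro extensionalityI[OF _ ext]) (auto simp: monomial_auto_def)
  moreover have "(l, w) \<in> carrier (semidirect_product torus autdiagr diagr_act)"
    using lw by (simp add: carrier_semidirect)
  ultimately show ?thesis by blast
qed

end

theorem proposition2p5:
  fixes q :: complex
  assumes "q \<noteq> 0" and "\<forall>n::nat. 0 < n \<longrightarrow> q ^ n \<noteq> 1"
  shows "AlgAutoGroup (Uq_plus_sl3 q) \<cong> semidirect_product torus autdiagr diagr_act"
proof -
  interpret generic_q q using assms by unfold_locales
  let ?S = "semidirect_product torus autdiagr diagr_act"
  interpret S: group ?S by (rule group_semidirect_torus)
  have carrier: "carrier (AlgAutoGroup (Uq_plus_sl3 q)) = alg_auto (Uq_plus_sl3 q)"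
    by (simp add: AlgAutoGroup_def)
  have "monomial_auto q \<in> hom ?S (AlgAutoGroup (Uq_plus_sl3 q))"
  proof (rule homI)
    fix g h assume gh: "g \<in> carrier ?S" "h \<in> carrier ?S"
    then obtain l w l' w' where lw: "g = (l, w)" "h = (l', w')" "bij w" "bij w'"
      unfolding carrier_semidirect by auto
    have Bij: "monomial_auto q g \<in> Bij (range (serre_coset q))" if "g \<in> carrier ?S" for g
      using monomial_auto_mem[OF that, of q] by (simp add: alg_auto_def carrier_Uq)
    have "monomial_auto q (g \<otimes>\<^bsub>?S\<^esub> h) = compose (range (serre_coset q)) (monomial_auto q g) (monomial_auto q h)"
    proof (rule extensionalityI)
      show "monomial_auto q (g \<otimes>\<^bsub>?S\<^esub> h) \<in> extensional (range (serre_coset q))"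
        using Bij[OF S.m_closed[OF gh]] by (rule Bij_imp_extensional)
      show "monomial_auto q (g \<otimes>\<^bsub>?S\<^esub> h) C = compose (range (serre_coset q)) (monomial_auto q g) (monomial_auto q h) C"
        if "C \<in> range (serre_coset q)" for C
        using that lw monomial_auto_comp by (auto simp: compose_def)
    qed (rule compose_extensional)
    then show "monomial_auto q (g \<otimes>\<^bsub>?S\<^esub> h) = monomial_auto q g \<otimes>\<^bsub>AlgAutoGroup (Uq_plus_sl3 q)\<^esub> monomial_auto q h"
      using Bij gh by (simp add: AlgAutoGroup_def BijGroup_def carrier_Uq)
  qed (simp add: carrier monomial_auto_mem)
  moreover have "monomial_auto q ` carrier ?S = carrier (AlgAutoGroup (Uq_plus_sl3 q))"
    unfolding carrier using monomial_auto_mem monomial_auto_surj by blast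
  ultimately have "monomial_auto q \<in> iso ?S (AlgAutoGroup (Uq_plus_sl3 q))"
    unfolding iso_iff using monomial_auto_inj by blast
  then show ?thesis by (intro S.iso_sym is_isoI)
qed

end
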